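(* Let $\omega$ and $\rho$ be states on a unital C$^*$-algebra $A$. Then $\rho$ is in the weak* closure of the set $\omega\circ\mathrm{E}(A)=\{\omega\circ\psi:\ \psi\in\mathrm{E}(A)\}$ if and only if $\|\rho|J\|\leq\|\omega|J\|$ for each ideal $J$ of $A$.
   Context: Ideals are norm closed and two-sided. $\mathrm{E}(A)$ denotes the set of all unital completely positive maps $A\to A$ of the form $x\mapsto\sum_{i=1}^n a_i^*xa_i$ with $n\in\mathbb{N}$, $a_i\in A$ and $\sum_{i=1}^n a_i^*a_i=1$. $\|\omega|J\|$ is the norm of the restriction of $\omega$ to $J$. *)

theory Defs
  imports "HOL-Analysis.Analysis"
begin

text \<open>
  The inherited axiom \<open>norm 1 = 1\<close> only excludes the zero algebra, which has no states.
\<close>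

class unital_cstar_algebra = real_normed_algebra_1 + banach +
  fixes cscale :: "complex \<Rightarrow> 'a \<Rightarrow> 'a" (infixr "*\<^sub>C" 75)
    and adj :: "'a \<Rightarrow> 'a"
  assumes cscale_of_real: "complex_of_real r *\<^sub>C x = r *\<^sub>R x"
    and cscale_add_left: "(c + d) *\<^sub>C x = c *\<^sub>C x + d *\<^sub>C x"
    and cscale_add_right: "c *\<^sub>C (x + y) = c *\<^sub>C x + c *\<^sub>C y"
    and cscale_cscale: "c *\<^sub>C d *\<^sub>C x = (c * d) *\<^sub>C x"
    and cscale_mult_left: "(c *\<^sub>C x) * y = c *\<^sub>C (x * y)"
    and cscale_mult_right: "x * (c *\<^sub>C y) = c *\<^sub>C (x * y)"
    and norm_cscale: "norm (c *\<^sub>C x) = cmod c * norm x"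
    and adj_adj: "adj (adj x) = x"
    and adj_add: "adj (x + y) = adj x + adj y"
    and adj_cscale: "adj (c *\<^sub>C x) = cnj c *\<^sub>C adj x"
    and adj_mult: "adj (x * y) = adj y * adj x"
    and cstar_identity: "norm (adj x * x) = (norm x)\<^sup>2"

definition cdual :: "('a::unital_cstar_algebra \<Rightarrow> complex) set" where
  "cdual = {f. bounded_linear f \<and> (\<forall>c x. f (c *\<^sub>C x) = c * f x)}"

text \<open>
  The topology of pointwise convergence on the dual, i.e. the coarsest topology on it for which
  all evaluations \<open>f \<mapsto> f x\<close> are continuous.
\<close>

definition weak_star_topology :: "('a::unital_cstar_algebra \<Rightarrow> complex) topology" where
  "weak_star_topology = subtopology (product_topology (\<lambda>_. euclidean) UNIV) cdual"

definition state :: "('a::unital_cstar_algebra \<Rightarrow> complex) \<Rightarrow> bool" where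
  "state f \<longleftrightarrow> f \<in> cdual \<and> (\<forall>x. f (adj x * x) \<in> \<real>\<^sub>\<ge>\<^sub>0) \<and> onorm f = 1"

definition cstar_ideal :: "'a::unital_cstar_algebra set \<Rightarrow> bool" where
  "cstar_ideal J \<longleftrightarrow> closed J \<and> 0 \<in> J \<and> (\<forall>x\<in>J. \<forall>y\<in>J. x + y \<in> J) \<and> (\<forall>c. \<forall>x\<in>J. c *\<^sub>C x \<in> J)
     \<and> (\<forall>a. \<forall>x\<in>J. a * x \<in> J \<and> x * a \<in> J)"

text \<open>
  The analogue of \<^const>\<open>onorm\<close> for the restriction of \<open>f\<close> to a subspace;
  the point \<open>0\<close> contributes \<open>0 / 0 = 0\<close>.
\<close>

definition onorm_on :: "'a::real_normed_vector set \<Rightarrow> ('a \<Rightarrow> 'b::real_normed_vector) \<Rightarrow> real" where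
  "onorm_on J f = (SUP x\<in>J. norm (f x) / norm x)"

text \<open>
  Maps of this form are automatically unital and completely positive: on matrices,
  \<open>B\<^sup>* B\<close> is sent to the sum of the \<open>(B D\<^sub>i)\<^sup>* (B D\<^sub>i)\<close>, where \<open>D\<^sub>i\<close> is the diagonal
  matrix with all diagonal entries \<open>a i\<close>.
\<close>

definition elementary_ucp :: "('a::unital_cstar_algebra \<Rightarrow> 'a) set" where
  "elementary_ucp = {\<psi>. \<exists>(n::nat) (a :: nat \<Rightarrow> 'a).
     (\<Sum>i<n. adj (a i) * a i) = 1 \<and> \<psi> = (\<lambda>x. \<Sum>i<n. adj (a i) * x * a i)}"

end

theory Submission
  imports Defs
begin

text \<open>
For the easy direction, a map \<open>\<psi>\<close> of the given form is contractive and leaves every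
ideal \<open>J\<close> invariant, so \<open>\<bar>\<omega> (\<psi> x)\<bar> \<le> \<parallel>\<omega>|J\<parallel> \<parallel>x\<parallel>\<close> for \<open>x \<in> J\<close>, and such a bound
survives pointwise limits.

Conversely, the set of all \<open>\<omega> \<circ> \<psi>\<close> is convex, so by separation it is enough to find, for
every self-adjoint \<open>h\<close> and \<open>\<epsilon> > 0\<close>, a \<open>\<psi>\<close> with \<open>\<omega> (\<psi> h) \<ge> \<rho> h - \<epsilon>\<close>. By an affine
change of \<open>h\<close> we may take \<open>0 \<le> h \<le> 1\<close>. Cut \<open>h\<close> into horizontal layers: with
\<open>p\<^sub>k = (h - k/N)\<^sub>+\<close> the elements \<open>f\<^sub>k = N (p\<^sub>k - p\<^sub>k\<^sub>+\<^sub>1)\<close> satisfy \<open>0 \<le> f\<^sub>k \<le> 1\<close>, average to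
\<open>h\<close>, and lie in the ideal \<open>I\<^sub>k\<close> generated algebraically by \<open>p\<^sub>k\<close>. Two facts are combined.

  \<^item> The norm of \<open>\<omega>\<close> on the closure of \<open>I\<^sub>k\<close> is at most the supremum of \<open>\<omega> (1 - (1 + a)\<^sup>-\<^sup>1)\<close>
  over positive \<open>a \<in> I\<^sub>k\<close> (\<open>onorm_on_closure_le\<close>). The hypothesis
  therefore yields \<open>a\<^sub>k \<in> I\<^sub>k\<close> with \<open>\<omega> (1 - (1 + a\<^sub>k)\<^sup>-\<^sup>1) \<ge> \<rho> f\<^sub>k - \<epsilon>\<close>. Since inversion reverses
  the order, \<open>e\<^sub>k = 1 - (1 + \<Sum>\<^sub>j\<^sub>\<ge>\<^sub>k a\<^sub>j)\<^sup>-\<^sup>1\<close> dominates this element, and the \<open>e\<^sub>k\<close> decrease in \<open>k\<close>.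
  \<^item> On a positive element \<open>d\<close> of \<open>I\<^sub>k\<close>, \<open>h\<close> can be pushed forward as if it were at least
  \<open>k/N\<close>: there are finitely many \<open>c\<^sub>i\<close> such that \<open>\<Sum> c\<^sub>i\<^sup>* c\<^sub>i\<close> is at most \<open>d\<close>, is almost \<open>d\<close>, and
  \<open>\<Sum> c\<^sub>i\<^sup>* h c\<^sub>i \<ge> (k/N) \<Sum> c\<^sub>i\<^sup>* c\<^sub>i\<close> (\<open>ideal_gen_approximated_by_value_at_one\<close>).

Applying the second fact to \<open>d\<^sub>k = e\<^sub>k - e\<^sub>k\<^sub>+\<^sub>1\<close> and adding one more summand to make the sum unital
gives \<open>\<psi>\<close> with \<open>\<omega> (\<psi> h)\<close> at least about \<open>\<Sum> (k/N) \<omega> d\<^sub>k\<close>, which by partial summation is about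
\<open>(1/N) \<Sum> \<omega> e\<^sub>k \<ge> (1/N) \<Sum> \<rho> f\<^sub>k = \<rho> h\<close>, up to errors of the order of \<open>\<epsilon>\<close> and \<open>1/N\<close>.

The order theory of C*-algebras that this uses is developed without spectra or functional
calculus. Positivity of \<open>a\<close> is expressed by \<open>\<parallel>t - a\<parallel> \<le> t\<close>, which makes the cone property
obvious. Square roots come from an iteration, and norms are estimated by completing
commuting self-adjoint \<open>a, b\<close> with \<open>a\<^sup>2 + b\<^sup>2 = t\<^sup>2\<close> to the multiple \<open>a + \<i> b\<close> of a unitary.
\<close>

section \<open>The involution\<close>

lemma adj_zero [simp]: "adj 0 = (0::'a::unital_cstar_algebra)"
  using adj_add[of "0::'a" 0] by simp

lemma adj_minus: "adj (- x) = - adj (x::'a::unital_cstar_algebra)"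
  using adj_add[of x "- x"] by (simp add: eq_neg_iff_add_eq_0 add.commute)

lemma adj_diff: "adj (x - y) = adj x - adj (y::'a::unital_cstar_algebra)"
  using adj_add[of x "- y"] by (simp add: adj_minus)

lemma adj_one [simp]: "adj 1 = (1::'a::unital_cstar_algebra)"
  using adj_mult[of "adj (1::'a)" 1] by (simp add: adj_adj)

lemma adj_scaleR: "adj (r *\<^sub>R x) = r *\<^sub>R adj (x::'a::unital_cstar_algebra)"
  by (metis adj_cscale complex_cnj_complex_of_real cscale_of_real)

lemma norm_adj [simp]: "norm (adj x) = norm (x::'a::unital_cstar_algebra)"
proof -
  have le: "norm y \<le> norm (adj y)" for y :: 'a
  proof (cases "norm y = 0")
    case False
    have "norm y * norm y \<le> norm (adj y) * norm y"
      using cstar_identity[of y] norm_mult_ineq[of "adj y" y] by (simp add: power2_eq_square)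
    then show ?thesis using False by (simp add: mult_le_cancel_right)
  qed simp
  show ?thesis using le[of x] le[of "adj x"] by (simp add: adj_adj)
qed

lemma norm_mult_adj: "norm (x * adj x) = (norm (x::'a::unital_cstar_algebra))\<^sup>2"
  using cstar_identity[of "adj x"] by (simp add: adj_adj)

lemma bounded_linear_adj: "bounded_linear (adj :: 'a::unital_cstar_algebra \<Rightarrow> 'a)"
  by (rule bounded_linear_intro[where K=1]) (auto simp: adj_add adj_scaleR)

lemma norm_square_selfadjoint:
  "adj a = a \<Longrightarrow> norm (a * a) = (norm (a::'a::unital_cstar_algebra))\<^sup>2"
  using cstar_identity[of a] by simp

lemma cscale_zero_left [simp]: "0 *\<^sub>C x = (0::'a::unital_cstar_algebra)"
  using cscale_of_real[of 0 x] by simp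

lemma cscale_one [simp]: "1 *\<^sub>C x = (x::'a::unital_cstar_algebra)"
  using cscale_of_real[of 1 x] by simp

lemma cscale_minus_left: "(- c) *\<^sub>C x = - (c *\<^sub>C (x::'a::unital_cstar_algebra))"
  using cscale_add_left[of "-c" c x] by (simp add: eq_neg_iff_add_eq_0)

lemma cscale_zero_right [simp]: "c *\<^sub>C 0 = (0::'a::unital_cstar_algebra)"
  using cscale_add_right[of c 0 "0::'a"] by simp

lemma cscale_minus_right: "c *\<^sub>C (- x) = - (c *\<^sub>C (x::'a::unital_cstar_algebra))"
  using cscale_add_right[of c "-x" x] by (simp add: eq_neg_iff_add_eq_0)

lemma cscale_diff_right: "c *\<^sub>C (x - y) = c *\<^sub>C x - c *\<^sub>C (y::'a::unital_cstar_algebra)"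
  using cscale_add_right[of c x "-y"] by (simp add: cscale_minus_right)

lemma ii_ii_cscale: "\<i> *\<^sub>C \<i> *\<^sub>C x = - (x::'a::unital_cstar_algebra)"
  by (simp add: cscale_cscale cscale_minus_left)

lemma cartesian_decomposition:
  fixes x :: "'a::unital_cstar_algebra"
  obtains b c where "adj b = b" "adj c = c" "x = b + \<i> *\<^sub>C c"
proof
  show "adj ((1/2) *\<^sub>R (x + adj x)) = (1/2) *\<^sub>R (x + adj x)"
    by (simp add: adj_scaleR adj_add adj_adj add.commute)
  show "adj ((-\<i>) *\<^sub>C ((1/2) *\<^sub>R (x - adj x))) = (-\<i>) *\<^sub>C ((1/2) *\<^sub>R (x - adj x))"
  proof -
    have "adj ((1/2) *\<^sub>R (x - adj x)) = - ((1/2) *\<^sub>R (x - adj x))"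
      by (simp add: adj_scaleR adj_diff adj_adj flip: scaleR_minus_right)
    then show ?thesis
      unfolding adj_cscale by (simp add: cscale_minus_right cscale_minus_left)
  qed
  have "\<i> *\<^sub>C (-\<i>) *\<^sub>C y = y" for y :: 'a
    by (simp add: cscale_cscale)
  then show "x = (1/2) *\<^sub>R (x + adj x) + \<i> *\<^sub>C (-\<i>) *\<^sub>C ((1/2) *\<^sub>R (x - adj x))"
    by (simp add: scaleR_add_right scaleR_diff_right flip: scaleR_add_left)
qed

text \<open>
Here \<open>a + \<i> b\<close> is \<open>t\<close> times an isometry, and \<open>a\<close> is its real part. This replaces the spectral
radius formula: it turns algebraic relations between self-adjoint elements into norm bounds.
\<close>

lemma norm_le_if_sum_squares:
  fixes a b :: "'a::unital_cstar_algebra"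
  assumes a: "adj a = a" and b: "adj b = b" and ab: "a * b = b * a"
    and sq: "a * a + b * b = t\<^sup>2 *\<^sub>R 1" and t: "t \<ge> 0"
  shows "norm a \<le> t"
proof -
  define u where "u = a + \<i> *\<^sub>C b"
  have au: "adj u = a - \<i> *\<^sub>C b"
    by (simp add: u_def adj_add adj_cscale a b cscale_minus_left)
  have "adj u * u = a * a + b * b"
    unfolding au by (simp add: u_def algebra_simps cscale_mult_left cscale_mult_right cscale_diff_right
        cscale_add_right ii_ii_cscale ab)
  then have "(norm u)\<^sup>2 = t\<^sup>2"
    using cstar_identity[of u] sq by simp
  then have "norm u = t" using t by simp
  moreover have "2 *\<^sub>R a = u + adj u" unfolding au by (simp add: u_def scaleR_2)
  then have "2 * norm a \<le> norm u + norm (adj u)"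
    by (metis norm_triangle_ineq norm_scaleR abs_numeral)
  ultimately show ?thesis by simp
qed

section \<open>Square roots\<close>

text \<open>
The iteration for the fixed point \<open>y = (x + y\<^sup>2) / 2\<close>, that is, \<open>(1 - y)\<^sup>2 = 1 - x\<close>.
\<close>

fun sqrt_iter :: "'a::real_normed_algebra_1 \<Rightarrow> nat \<Rightarrow> 'a" where
  "sqrt_iter x 0 = 0"
| "sqrt_iter x (Suc n) = (1/2) *\<^sub>R (x + sqrt_iter x n * sqrt_iter x n)"

lemma sqrt_iter_one_bounds:
  "0 \<le> sqrt_iter (1::real) n \<and> sqrt_iter (1::real) n \<le> 1 
    \<and> sqrt_iter (1::real) n \<le> sqrt_iter 1 (Suc n)"
proof -
  have a: "0 \<le> sqrt_iter (1::real) n \<and> sqrt_iter (1::real) n \<le> 1"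
  proof (induction n)
    case (Suc n)
    then have "sqrt_iter (1::real) n * sqrt_iter 1 n \<le> 1" by (simp add: mult_le_one)
    then show ?case using Suc by simp
  qed simp
  moreover have "0 \<le> (sqrt_iter (1::real) n - 1)\<^sup>2" by simp
  ultimately show ?thesis by (simp add: power2_eq_square algebra_simps)
qed

text \<open>
For \<open>\<parallel>x\<parallel> \<le> 1\<close>, both the iterates and their increments are majorised by those for the real
number \<open>1\<close>, which increase and are bounded. Hence the iteration converges even on the boundary
\<open>\<parallel>x\<parallel> = 1\<close>, where a contraction argument would fail.
\<close>

lemma sqrt_iter_majorised:
  assumes "norm x \<le> 1"
  shows "norm (sqrt_iter x n) \<le> sqrt_iter 1 n"
    and "norm (sqrt_iter x (Suc n) - sqrt_iter x n) \<le> sqrt_iter 1 (Suc n) - sqrt_iter 1 n"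
proof -
  show b: "norm (sqrt_iter x n) \<le> sqrt_iter 1 n" for n
  proof (induction n)
    case (Suc n)
    have "norm (sqrt_iter x n * sqrt_iter x n) \<le> sqrt_iter 1 n * sqrt_iter 1 n"
      using Suc norm_mult_ineq[of "sqrt_iter x n" "sqrt_iter x n"]
      by (meson mult_mono norm_ge_zero order_trans)
    then have "norm (x + sqrt_iter x n * sqrt_iter x n) \<le> 1 + sqrt_iter 1 n * sqrt_iter 1 n"
      using assms by (meson add_mono norm_triangle_ineq order_trans)
    then show ?case by simp
  qed simp
  show "norm (sqrt_iter x (Suc n) - sqrt_iter x n) \<le> sqrt_iter 1 (Suc n) - sqrt_iter 1 n"
  proof (induction n)
    case (Suc n)
    define y z where "y = sqrt_iter x (Suc n)" and "z = sqrt_iter x n"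
    define p q :: real where "p = sqrt_iter 1 (Suc n)" and "q = sqrt_iter 1 n"
    have d: "norm (y - z) \<le> p - q" using Suc by (simp only: y_def z_def p_def q_def)
    have yb: "norm y \<le> p" and zb: "norm z \<le> q" unfolding y_def z_def p_def q_def by (rule b)+
    have "norm ((y - z) * y + z * (y - z)) \<le> (p - q) * p + q * (p - q)"
    proof (rule norm_triangle_le[OF add_mono])
      show "norm ((y - z) * y) \<le> (p - q) * p"
        using d yb by (meson mult_mono norm_ge_zero norm_mult_ineq order_trans)
      show "norm (z * (y - z)) \<le> q * (p - q)"
        using d zb by (meson mult_mono norm_ge_zero norm_mult_ineq order_trans)
    qed
    moreover have "sqrt_iter x (Suc (Suc n)) - sqrt_iter x (Suc n) = 
        (1/2) *\<^sub>R ((y - z) * y + z * (y - z))"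
      by (subst (1 2) sqrt_iter.simps(2))
         (simp add: y_def[symmetric] z_def[symmetric] algebra_simps del: sqrt_iter.simps)
    moreover have "sqrt_iter 1 (Suc (Suc n)) - sqrt_iter 1 (Suc n) = (1/2) * ((p - q) * p + q * (p - q))"
      by (subst (1 2) sqrt_iter.simps(2))
         (simp add: p_def[symmetric] q_def[symmetric] field_simps del: sqrt_iter.simps)
    ultimately show ?case by simp
  qed (use assms in simp)
qed

lemma sqrt_iter_converges:
  fixes x :: "'a::{real_normed_algebra_1, banach}"
  assumes "norm x \<le> 1"
  obtains y where "sqrt_iter x \<longlonglongrightarrow> y" "norm y \<le> 1" "y = (1/2) *\<^sub>R (x + y * y)"
proof -
  have "incseq (sqrt_iter (1::real))" using sqrt_iter_one_bounds by (intro incseq_SucI) blast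
  then have "convergent (sqrt_iter (1::real))"
    using sqrt_iter_one_bounds by (intro Bseq_mono_convergent BseqI'[where K=1]) (auto simp: incseq_def)
  then have "summable (\<lambda>n. sqrt_iter (1::real) (Suc n) - sqrt_iter 1 n)"
    using telescope_summable[of "sqrt_iter (1::real)"] by (auto simp: convergent_def simp del: sqrt_iter.simps)
  then have "summable (\<lambda>n. norm (sqrt_iter x (Suc n) - sqrt_iter x n))"
    by (rule summable_comparison_test[rotated])
       (use sqrt_iter_majorised(2)[OF assms] in \<open>auto simp del: sqrt_iter.simps\<close>)
  then have "summable (\<lambda>n. sqrt_iter x (Suc n) - sqrt_iter x n)" by (rule summable_norm_cancel)
  then have "convergent (\<lambda>n. \<Sum>i<n. sqrt_iter x (Suc i) - sqrt_iter x i)"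
    by (simp add: summable_iff_convergent)
  then obtain y where lim: "sqrt_iter x \<longlonglongrightarrow> y"
    by (auto simp: sum_lessThan_telescope convergent_def simp del: sqrt_iter.simps(2))
  have "norm (sqrt_iter x n) \<le> 1" for n
    using sqrt_iter_majorised(1)[OF assms, of n] sqrt_iter_one_bounds[of n] by linarith
  then have "norm y \<le> 1"
    by (intro Lim_bounded[OF tendsto_norm[OF lim]]) auto
  moreover have "(\<lambda>n. sqrt_iter x (Suc n)) \<longlonglongrightarrow> (1/2) *\<^sub>R (x + y * y)"
    unfolding sqrt_iter.simps by (intro tendsto_intros lim)
  then have "y = (1/2) *\<^sub>R (x + y * y)"
    using LIMSEQ_unique lim LIMSEQ_Suc by blast
  ultimately show ?thesis using lim that by blast
qed

section \<open>Positive elements\<close>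

definition pos :: "'a::unital_cstar_algebra \<Rightarrow> bool" where
  "pos a \<longleftrightarrow> adj a = a \<and> (\<exists>t. norm (t *\<^sub>R 1 - a) \<le> t)"

abbreviation cle :: "'a::unital_cstar_algebra \<Rightarrow> 'a \<Rightarrow> bool" (infix "\<preceq>" 50) where
  "a \<preceq> b \<equiv> pos (b - a)"

lemma pos_adj: "pos a \<Longrightarrow> adj a = a"
  by (simp add: pos_def)

lemma pos_zero [simp]: "pos 0" and pos_one [simp]: "pos 1"
  unfolding pos_def by (auto intro!: exI[of _ 1])

lemma pos_add: "pos a \<Longrightarrow> pos b \<Longrightarrow> pos (a + b)"
proof -
  assume "pos a" "pos b"
  then obtain t s where a: "adj a = a" "adj b = b" and ts: "norm (t *\<^sub>R 1 - a) \<le> t" "norm (s *\<^sub>R 1 - b) \<le> s"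
    unfolding pos_def by blast
  have "norm ((t + s) *\<^sub>R 1 - (a + b)) \<le> t + s"
    using norm_triangle_mono[OF ts] by (simp add: algebra_simps)
  then show ?thesis using a unfolding pos_def adj_add by auto
qed

lemma pos_scaleR: "pos a \<Longrightarrow> r \<ge> 0 \<Longrightarrow> pos (r *\<^sub>R a)"
proof -
  assume "pos a" and r: "r \<ge> 0"
  then obtain t where a: "adj a = a" and t: "norm (t *\<^sub>R 1 - a) \<le> t" unfolding pos_def by blast
  have "norm ((r * t) *\<^sub>R 1 - r *\<^sub>R a) = r * norm (t *\<^sub>R 1 - a)"
    using r by (metis abs_of_nonneg norm_scaleR scaleR_diff_right scaleR_scaleR)
  then have "norm ((r * t) *\<^sub>R 1 - r *\<^sub>R a) \<le> r * t" using t r by (simp add: mult_left_mono)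
  then show ?thesis using a unfolding pos_def adj_scaleR by auto
qed

lemma pos_scaleR_one: "r \<ge> 0 \<Longrightarrow> pos (r *\<^sub>R 1)"
  by (simp add: pos_scaleR)

lemma pos_sum: "(\<And>i. i \<in> S \<Longrightarrow> pos (f i)) \<Longrightarrow> pos (\<Sum>i\<in>S. f i)"
  by (induction S rule: infinite_finite_induct) (auto intro: pos_add)

lemma cle_trans [trans]: "a \<preceq> b \<Longrightarrow> b \<preceq> c \<Longrightarrow> a \<preceq> c"
  using pos_add[of "b - a" "c - b"] by (simp add: algebra_simps)

lemma cle_norm: "adj a = a \<Longrightarrow> a \<preceq> norm a *\<^sub>R 1"
  unfolding pos_def by (auto simp: adj_diff adj_scaleR intro!: exI[of _ "norm a"])

text \<open>
The root is a limit of polynomials in \<open>a\<close>, so it commutes with everything that commutes with \<open>a\<close>.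
\<close>

lemma pos_sqrt:
  assumes "pos a"
  obtains b where "pos b" "b * b = a" "\<And>x. x * a = a * x \<Longrightarrow> x * b = b * x"
proof -
  obtain t where a: "adj a = a" and t: "norm (t *\<^sub>R 1 - a) \<le> t"
    using assms unfolding pos_def by blast
  have "t \<ge> 0" using t norm_ge_zero order_trans by blast
  show ?thesis
  proof (cases "t = 0")
    case True
    then have "a = 0" using t by simp
    then show ?thesis using that[of 0] by simp
  next
    case False
    then have t0: "t > 0" using \<open>t \<ge> 0\<close> by simp
    define x where "x = 1 - (1/t) *\<^sub>R a"
    have "x = (1/t) *\<^sub>R (t *\<^sub>R 1 - a)" using t0 by (simp add: x_def algebra_simps)
    then have "norm x \<le> 1" using t t0 by (simp add: divide_le_eq)
    then obtain y where lim: "sqrt_iter x \<longlonglongrightarrow> y" and y1: "norm y \<le> 1" and y: "y = (1/2) *\<^sub>R (x + y * y)"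
      using sqrt_iter_converges by blast
    have "adj x = x" by (simp add: x_def adj_diff adj_scaleR a)
    then have "adj (sqrt_iter x n) = sqrt_iter x n" for n
      by (induction n) (auto simp: adj_scaleR adj_add adj_mult)
    moreover have "(\<lambda>n. adj (sqrt_iter x n)) \<longlonglongrightarrow> adj y"
      by (rule bounded_linear.tendsto[OF bounded_linear_adj lim])
    ultimately have ay: "adj y = y" using lim LIMSEQ_unique by simp
    have comm: "z * y = y * z" if "z * a = a * z" for z
    proof -
      have zx: "z * x = x * z" using that by (simp add: x_def algebra_simps)
      have "z * sqrt_iter x n = sqrt_iter x n * z" for n
      proof (induction n)
        case (Suc n)
        have "z * (sqrt_iter x n * sqrt_iter x n) = sqrt_iter x n * sqrt_iter x n * z"
          by (metis Suc mult.assoc)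
        then show ?case using zx by (simp add: distrib_left distrib_right)
      qed simp
      moreover have "(\<lambda>n. z * sqrt_iter x n) \<longlonglongrightarrow> z * y" "(\<lambda>n. sqrt_iter x n * z) \<longlonglongrightarrow> y * z"
        by (intro tendsto_intros lim)+
      ultimately show ?thesis using LIMSEQ_unique by auto
    qed
    have "2 *\<^sub>R y = 2 *\<^sub>R ((1/2) *\<^sub>R (x + y * y))" using y by simp
    then have "2 *\<^sub>R y = x + y * y" by simp
    then have sq: "(1 - y) * (1 - y) = (1/t) *\<^sub>R a"
      by (simp add: algebra_simps x_def scaleR_2)
    show ?thesis
    proof (rule that[of "sqrt t *\<^sub>R (1 - y)"])
      have "pos (1 - y)" unfolding pos_def using y1 ay
        by (auto simp: adj_diff intro!: exI[of _ 1])
      then show "pos (sqrt t *\<^sub>R (1 - y))" using t0 by (intro pos_scaleR) auto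
      show "sqrt t *\<^sub>R (1 - y) * sqrt t *\<^sub>R (1 - y) = a"
        using t0 by (simp add: sq)
    qed (simp add: comm right_diff_distrib left_diff_distrib)
  qed
qed

text \<open>
After normalisation \<open>\<parallel>a\<parallel> = 1\<close>, let \<open>b\<close> be a square root of \<open>1 - a\<^sup>2\<close>. Then
\<open>a\<^sup>2 + b\<^sup>2 = 1\<close> forces \<open>\<parallel>b\<parallel> \<le> 1\<close>, so that \<open>\<parallel>1 - a\<^sup>2\<parallel> = \<parallel>b\<parallel>\<^sup>2 \<le> 1\<close>, which is the norm criterion for \<open>a\<^sup>2\<close>.
\<close>

lemma pos_square:
  assumes a: "adj a = a"
  shows "pos (a * a)"
proof (cases "a = 0")
  case False
  define n where "n = norm a"
  have n: "n > 0" using False by (simp add: n_def)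
  define x where "x = (1/n\<^sup>2) *\<^sub>R (a * a)"
  have ax: "adj x = x" by (simp add: x_def adj_scaleR adj_mult a)
  have "norm x = 1"
    using n norm_square_selfadjoint[OF a] by (simp add: x_def n_def)
  then have "pos (1 - x)" unfolding pos_def using ax by (auto simp: adj_diff intro!: exI[of _ 1])
  then obtain b where b: "pos b" "b * b = 1 - x" "\<And>y. y * (1 - x) = (1 - x) * y \<Longrightarrow> y * b = b * y"
    using pos_sqrt by blast
  have "a * b = b * a" by (rule b(3)) (simp add: x_def algebra_simps)
  then have "norm b \<le> 1"
    using b(2) n
    by (intro norm_le_if_sum_squares[of b "(1/n) *\<^sub>R a"])
       (auto simp: pos_adj[OF b(1)] adj_scaleR a x_def power2_eq_square)
  then have "norm (1 - x) \<le> 1" using b(2) norm_square_selfadjoint[OF pos_adj[OF b(1)]]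
    by (simp add: power_le_one)
  then have "pos x" unfolding pos_def using ax by (auto intro!: exI[of _ 1])
  then have "pos (n\<^sup>2 *\<^sub>R x)" by (intro pos_scaleR) auto
  then show ?thesis using n by (simp add: x_def)
qed simp

lemma pos_mult_commuting:
  assumes "pos a" "pos b" "a * b = b * a"
  shows "pos (a * b)"
proof -
  obtain p where p: "pos p" "p * p = a" "\<And>x. x * a = a * x \<Longrightarrow> x * p = p * x" using pos_sqrt[OF assms(1)] by blast
  obtain q where q: "pos q" "q * q = b" "\<And>x. x * b = b * x \<Longrightarrow> x * q = q * x" using pos_sqrt[OF assms(2)] by blast
  have "b * p = p * b" using p(3)[of b] assms(3) by simp
  then have pq: "p * q = q * p" using q(3)[of p] by simp
  have "(p * q) * (p * q) = a * b"
    by (metis pq p(2) q(2) mult.assoc)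
  moreover have "pos ((p * q) * (p * q))"
    by (rule pos_square) (simp add: adj_mult pos_adj p(1) q(1) pq)
  ultimately show ?thesis by simp
qed

text \<open>
The product \<open>(t + a) (t - a) = t\<^sup>2 - a\<^sup>2\<close> of commuting positive elements is a square \<open>f\<^sup>2\<close>, and
\<open>a\<^sup>2 + f\<^sup>2 = t\<^sup>2\<close>.
\<close>

lemma norm_le_if_cle:
  assumes "- (t *\<^sub>R 1) \<preceq> a" "a \<preceq> t *\<^sub>R 1" "t \<ge> 0"
  shows "norm a \<le> t"
proof -
  have p: "pos (t *\<^sub>R 1 + a)" "pos (t *\<^sub>R 1 - a)" using assms by (auto simp: algebra_simps)
  have a: "adj a = a" using pos_adj[OF p(1)] by (simp add: adj_add adj_scaleR)
  have "pos ((t *\<^sub>R 1 + a) * (t *\<^sub>R 1 - a))"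
    by (rule pos_mult_commuting[OF p]) (simp add: algebra_simps)
  moreover have "(t *\<^sub>R 1 + a) * (t *\<^sub>R 1 - a) = t\<^sup>2 *\<^sub>R 1 - a * a"
    by (simp add: algebra_simps power2_eq_square)
  ultimately obtain f where f: "pos f" "f * f = t\<^sup>2 *\<^sub>R 1 - a * a"
      "\<And>x. x * (t\<^sup>2 *\<^sub>R 1 - a * a) = (t\<^sup>2 *\<^sub>R 1 - a * a) * x \<Longrightarrow> x * f = f * x"
    using pos_sqrt by metis
  have "a * f = f * a" by (rule f(3)) (simp add: algebra_simps)
  then show ?thesis
    using f(2) by (intro norm_le_if_sum_squares[OF a pos_adj[OF f(1)]]) (auto simp: assms)
qed

lemma norm_pos_le_if_cle: "pos a \<Longrightarrow> a \<preceq> t *\<^sub>R 1 \<Longrightarrow> t \<ge> 0 \<Longrightarrow> norm a \<le> t"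
  using pos_add[OF _ pos_scaleR_one, of a t] by (intro norm_le_if_cle) auto

lemma norm_mono_pos: "pos a \<Longrightarrow> a \<preceq> b \<Longrightarrow> norm a \<le> norm b"
proof -
  assume a: "pos a" and ab: "a \<preceq> b"
  have "adj b = b" using pos_adj[OF pos_add[OF a ab]] by simp
  then have "a \<preceq> norm b *\<^sub>R 1" using ab cle_norm cle_trans by blast
  then show ?thesis using a by (intro norm_pos_le_if_cle) auto
qed

lemma pos_antisym: "pos a \<Longrightarrow> pos (- a) \<Longrightarrow> a = 0"
  using norm_mono_pos[of a 0] by simp

lemma cle_one_if_norm_le: "adj a = a \<Longrightarrow> norm a \<le> 1 \<Longrightarrow> a \<preceq> 1"
  unfolding pos_def by (auto simp: adj_diff intro!: exI[of _ 1])

lemma pos_norm_criterion: "pos a \<Longrightarrow> norm a \<le> t \<Longrightarrow> norm (t *\<^sub>R 1 - a) \<le> t"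
proof (rule norm_pos_le_if_cle)
  assume a: "pos a" and t: "norm a \<le> t"
  have "pos (norm a *\<^sub>R 1 - a)" "pos ((t - norm a) *\<^sub>R 1)"
    using a t by (auto intro!: cle_norm pos_scaleR_one pos_adj)
  from pos_add[OF this] show "pos (t *\<^sub>R 1 - a)" by (simp add: algebra_simps)
  show "t \<ge> 0" using t norm_ge_zero order_trans by blast
qed simp

text \<open>
The existential \<open>t\<close> in the definition of positivity can be chosen uniformly near \<open>a\<close>, so the cone
is closed.
\<close>

lemma pos_if_approx:
  assumes "\<And>\<epsilon>. \<epsilon> > 0 \<Longrightarrow> pos (a + \<epsilon> *\<^sub>R 1)"
  shows "pos a"
proof -
  have a: "adj a = a" using pos_adj[OF assms[of 1]] by (simp add: adj_add)
  have "norm ((norm a + 1) *\<^sub>R 1 - a) \<le> norm a + 1"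
  proof (rule field_le_epsilon)
    fix e :: real assume e: "0 < e"
    have "norm (a + (e/2) *\<^sub>R 1) \<le> norm a + e/2" using norm_triangle_ineq[of a "(e/2) *\<^sub>R 1"] e by simp
    then have "norm ((norm a + 1 + e/2) *\<^sub>R 1 - (a + (e/2) *\<^sub>R 1)) \<le> norm a + 1 + e/2"
      using e assms[of "e/2"] by (intro pos_norm_criterion) auto
    then show "norm ((norm a + 1) *\<^sub>R 1 - a) \<le> norm a + 1 + e" using e by (simp add: algebra_simps)
  qed
  then show ?thesis using a unfolding pos_def by blast
qed

section \<open>Inverses, positive parts and squares\<close>

lemma commutes_with_inverse:
  fixes x :: "'a::monoid_mult"
  assumes "c * b = 1" "b * c = 1" "x * c = c * x"
  shows "x * b = b * x"
proof -
  have "x * b = b * c * x * b" by (simp add: assms)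
  also have "\<dots> = b * x * (c * b)" by (simp add: mult.assoc assms(3)[symmetric])
  finally show ?thesis by (simp add: assms)
qed

text \<open>
With \<open>s = \<parallel>a\<parallel> + \<epsilon>\<close>, the element \<open>(a + \<epsilon>) / s\<close> is at distance less than \<open>1\<close> from \<open>1\<close>, so the
geometric series inverts it. The inverse \<open>b\<close> is positive, being \<open>(q b)\<^sup>2\<close> for a square root \<open>q\<close>
of \<open>a + \<epsilon>\<close>.
\<close>

lemma pos_shift_inverse:
  fixes a :: "'a::unital_cstar_algebra"
  assumes a: "pos a" and e: "\<epsilon> > 0"
  obtains b where "pos b" "(a + \<epsilon> *\<^sub>R 1) * b = 1" "b * (a + \<epsilon> *\<^sub>R 1) = 1" "\<epsilon> *\<^sub>R b \<preceq> 1"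
proof -
  define c where "c = a + \<epsilon> *\<^sub>R 1"
  define s where "s = norm a + \<epsilon>"
  have s: "s > 0" using e by (simp add: s_def add_nonneg_pos)
  have pc: "pos c" unfolding c_def using a e by (intro pos_add pos_scaleR_one) auto
  define y where "y = 1 - (1/s) *\<^sub>R c"
  have "y = (1/s) *\<^sub>R (s *\<^sub>R 1 - c)" using s by (simp add: y_def scaleR_diff_right)
  also have "s *\<^sub>R 1 - c = norm a *\<^sub>R 1 - a" by (simp add: s_def c_def scaleR_add_left)
  finally have "y = (1/s) *\<^sub>R (norm a *\<^sub>R 1 - a)" .
  then have "norm y \<le> norm a / s" using pos_norm_criterion[OF a order_refl] s by (simp add: divide_right_mono)
  also have "\<dots> < 1" using s e by (simp add: s_def)
  finally have sy: "summable (\<lambda>n. y ^ n)" by (rule complete_algebra_summable_geometric)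
  define g where "g = (\<Sum>n. y ^ n)"
  have "(\<Sum>n. y ^ Suc n) = y * g" unfolding g_def by (simp add: suminf_mult[OF sy])
  then have "y * g = g - 1" using suminf_split_head[OF sy] by (simp add: g_def)
  moreover have "g * y = y * g"
    unfolding g_def by (simp add: suminf_mult[OF sy, symmetric] suminf_mult2[OF sy] power_commutes)
  ultimately have g: "(1 - y) * g = 1" "g * (1 - y) = 1" by (simp_all add: algebra_simps)
  define b where "b = (1/s) *\<^sub>R g"
  have cb: "c * b = 1" and bc: "b * c = 1" using g by (simp_all add: b_def y_def)
  have ac: "adj c = c" using pos_adj[OF pc] .
  have "adj b = adj b * (c * b)" by (simp add: cb)
  also have "\<dots> = adj (c * b) * b" by (simp add: adj_mult ac mult.assoc)
  finally have ab: "adj b = b" by (simp add: cb)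
  obtain q where q: "pos q" "q * q = c" "\<And>x. x * c = c * x \<Longrightarrow> x * q = q * x" using pos_sqrt[OF pc] by blast
  have bq: "b * q = q * b" by (rule q(3)) (simp add: bc cb)
  have "(q * b) * (q * b) = b"
    by (metis bq q(2) cb mult.assoc mult_1_right)
  moreover have "adj (q * b) = q * b" by (simp add: adj_mult ab pos_adj[OF q(1)] bq)
  ultimately have pb: "pos b" using pos_square by metis
  have "pos (a * b)"
    by (rule pos_mult_commuting[OF a pb], rule commutes_with_inverse[OF cb bc]) (simp add: c_def algebra_simps)
  moreover have "a * b = 1 - \<epsilon> *\<^sub>R b" using cb by (simp add: c_def algebra_simps)
  ultimately show ?thesis using that pb cb bc by (simp add: c_def)
qed

text \<open>
Dividing by \<open>r + e\<close> reduces the claim to a norm bound: the square of \<open>a (r + e)\<^sup>-\<^sup>1\<close> equals that of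
\<open>r (r + e)\<^sup>-\<^sup>1\<close>, which lies between \<open>0\<close> and \<open>1\<close>.
\<close>

lemma selfadjoint_le_abs:
  fixes a :: "'a::unital_cstar_algebra"
  assumes a: "adj a = a" and r: "pos r" "r * r = a * a" and ar: "a * r = r * a"
  shows "a \<preceq> r"
proof (rule pos_if_approx)
  fix e :: real assume e: "e > 0"
  define c where "c = r + e *\<^sub>R 1"
  obtain b where b: "pos b" "c * b = 1" "b * c = 1" "e *\<^sub>R b \<preceq> 1"
    using pos_shift_inverse[OF r(1) e] unfolding c_def by blast
  have ab: "a * b = b * a" by (rule commutes_with_inverse[OF b(2,3)]) (simp add: c_def algebra_simps ar)
  have rb: "r * b = b * r" by (rule commutes_with_inverse[OF b(2,3)]) (simp add: c_def algebra_simps)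
  have rbe: "r * b = 1 - e *\<^sub>R b" using b(2) by (simp add: c_def algebra_simps)
  have "pos (1 - r * b)" unfolding rbe using b(1) e by (simp add: pos_scaleR)
  then have n1: "norm (r * b) \<le> 1"
    using pos_mult_commuting[OF r(1) b(1) rb] by (intro norm_pos_le_if_cle) auto
  have ay: "adj (a * b) = a * b" by (simp add: adj_mult a pos_adj[OF b(1)] ab)
  have "(a * b) * (a * b) = (r * b) * (r * b)"
    by (metis ab rb r(2) mult.assoc)
  then have "(norm (a * b))\<^sup>2 \<le> 1\<^sup>2"
    using norm_square_selfadjoint[OF ay] norm_mult_ineq[of "r * b" "r * b"] n1
    by (simp add: mult_le_one order_trans)
  then have "norm (a * b) \<le> 1" using power2_le_imp_le zero_le_one by blast
  then have "pos ((1 - a * b) * c)"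
  proof (intro pos_mult_commuting)
    show "pos (1 - a * b)" using ay \<open>norm (a * b) \<le> 1\<close> by (rule cle_one_if_norm_le)
    show "pos c" unfolding c_def using r e by (intro pos_add pos_scaleR_one) auto
    have "a * c = c * a" by (simp add: c_def algebra_simps ar)
    then have "c * (a * b) = a" "a * b * c = a"
      by (metis b(2) mult.assoc mult_1_right, simp add: mult.assoc b(3))
    then show "(1 - a * b) * c = c * (1 - a * b)"
      by (simp add: left_diff_distrib right_diff_distrib)
  qed
  moreover have "(1 - a * b) * c = r - a + e *\<^sub>R 1" 
    by (simp add: left_diff_distrib mult.assoc b(3)) (simp add: c_def)
  ultimately show "pos (r - a + e *\<^sub>R 1)" by simp
qed

text \<open>
The witness is \<open>(\<bar>a\<bar> + a) / 2\<close>.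
\<close>

lemma pos_part:
  fixes a :: "'a::unital_cstar_algebra"
  assumes a: "adj a = a"
  obtains p where "pos p" "a \<preceq> p" "p * (p - a) = 0" "\<And>x. x * a = a * x \<Longrightarrow> x * p = p * x"
proof -
  obtain r where r: "pos r" "r * r = a * a" "\<And>x. x * (a * a) = a * a * x \<Longrightarrow> x * r = r * x"
    using pos_sqrt[OF pos_square[OF a]] by blast
  have ar: "a * r = r * a" by (rule r(3)) (simp add: mult.assoc)
  have 1: "a \<preceq> r" using selfadjoint_le_abs[OF a r(1,2) ar] .
  have 2: "- a \<preceq> r" using selfadjoint_le_abs[of "- a" r] a r(1,2) ar by (simp add: adj_minus)
  define p where "p = (1/2) *\<^sub>R (r + a)"
  have pa: "p - a = (1/2) *\<^sub>R (r - a)"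
    by (simp add: p_def algebra_simps flip: scaleR_add_left)
  show ?thesis
  proof
    show "pos p" using pos_scaleR[OF 2, of "1/2"] by (simp add: p_def)
    show "a \<preceq> p" unfolding pa using 1 by (intro pos_scaleR) auto
    show "p * (p - a) = 0" unfolding pa by (simp add: p_def algebra_simps r(2) ar)
    fix x assume xa: "x * a = a * x"
    then have "x * (a * a) = a * a * x" by (metis mult.assoc)
    then have "x * r = r * x" by (rule r(3))
    then show "x * p = p * x" by (simp add: p_def xa algebra_simps)
  qed
qed

text \<open>
The step in the proof that \<open>x\<^sup>* x\<close> is positive that normally compares the spectra of \<open>y\<^sup>* y\<close> and
\<open>y y\<^sup>*\<close>. Put \<open>m = - y\<^sup>* y\<close> and \<open>M = \<parallel>m\<parallel>\<close>. Then \<open>(M - y y\<^sup>*) y = y (M + m)\<close>. The left side has norm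
at most \<open>M \<parallel>y\<parallel>\<close>, while the square of the norm of the right side is \<open>\<parallel>(M + m) m (M + m)\<parallel>\<close>, which is
at least \<open>2 M \<parallel>m\<^sup>2\<parallel> = 2 M\<^sup>3\<close>. So \<open>2 M\<^sup>3 \<le> M\<^sup>3\<close>.
\<close>

lemma adj_mult_self_neg_imp_zero:
  fixes y :: "'a::unital_cstar_algebra"
  assumes m: "pos (- (adj y * y))" and p: "pos (y * adj y)"
  shows "y = 0"
proof -
  define m where "m = - (adj y * y)"
  define M where "M = (norm y)\<^sup>2"
  have M: "M \<ge> 0" by (simp add: M_def)
  have pm: "pos m" using m by (simp add: m_def)
  have nm: "norm m = M" by (simp add: m_def M_def cstar_identity)
  define w where "w = M *\<^sub>R 1 + m"
  have aw: "adj w = w" by (simp add: w_def adj_add adj_scaleR pos_adj[OF pm])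
  have "(M *\<^sub>R 1 - y * adj y) * y = y * w"
    by (simp add: w_def m_def algebra_simps)
  moreover have "norm (M *\<^sub>R 1 - y * adj y) \<le> M"
    by (rule pos_norm_criterion[OF p]) (simp add: M_def norm_mult_adj)
  ultimately have "norm (y * w) \<le> M * norm y"
    by (metis mult_right_mono norm_ge_zero norm_mult_ineq order_trans)
  then have "(norm (y * w))\<^sup>2 \<le> (M * norm y)\<^sup>2" by (simp add: power_mono)
  also have "\<dots> = M ^ 3" by (simp add: M_def power2_eq_square power3_eq_cube)
  finally have u: "(norm (y * w))\<^sup>2 \<le> M ^ 3" .
  have "adj (y * w) * (y * w) = w * (adj y * y) * w" by (simp add: adj_mult aw mult.assoc)
  also have "\<dots> = - (w * m * w)" by (simp add: m_def)
  finally have u2: "norm (w * m * w) \<le> M ^ 3" using cstar_identity[of "y * w"] u by simp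
  have e: "w * m * w = M\<^sup>2 *\<^sub>R m + (2 * M) *\<^sub>R (m * m) + m * m * m"
    by (simp add: w_def algebra_simps power2_eq_square scaleR_2 flip: scaleR_add_left)
  have "pos (m * m)" using pos_square pm pos_adj by blast
  then have "pos (M\<^sup>2 *\<^sub>R m + m * m * m)"
    using pm M by (intro pos_add pos_scaleR pos_mult_commuting) (auto simp: mult.assoc)
  then have "norm ((2 * M) *\<^sub>R (m * m)) \<le> norm (w * m * w)"
    using \<open>pos (m * m)\<close> M by (intro norm_mono_pos pos_scaleR) (auto simp: e add.commute)
  also note u2
  also have "norm ((2 * M) *\<^sub>R (m * m)) = 2 * M ^ 3"
    using norm_square_selfadjoint[OF pos_adj[OF pm]] M by (simp add: nm power2_eq_square power3_eq_cube)
  finally have "M = 0" using M by simp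
  then show ?thesis by (simp add: M_def)
qed

text \<open>
Let \<open>n\<close> be the negative part of \<open>x\<^sup>* x\<close>. For \<open>y = x n\<close> we get \<open>y\<^sup>* y = - n\<^sup>3\<close>, while
\<open>y\<^sup>* y + y y\<^sup>*\<close> is a sum of squares of self-adjoint elements, so that \<open>y y\<^sup>*\<close> is positive and
the preceding lemma forces \<open>n = 0\<close>.
\<close>

theorem pos_adj_mult_self: "pos (adj x * (x::'a::unital_cstar_algebra))"
proof -
  define a where "a = adj x * x"
  have aa: "adj a = a" by (simp add: a_def adj_mult adj_adj)
  obtain p where p: "pos p" "a \<preceq> p" "p * (p - a) = 0" "\<And>x. x * a = a * x \<Longrightarrow> x * p = p * x"
    using pos_part[OF aa] by blast
  define n where "n = p - a"
  have pn: "pos n" and pn0: "p * n = 0" using p by (auto simp: n_def)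
  have np: "n * p = p * n" using p(4)[of p] p(4)[of a] by (simp add: n_def algebra_simps)
  have apn: "a = p - n" by (simp add: n_def)
  define y where "y = x * n"
  have yy: "adj y * y = - (n * n * n)"
  proof -
    have "adj y * y = n * a * n" by (simp add: y_def a_def adj_mult pos_adj[OF pn] mult.assoc)
    also have "\<dots> = - (n * n * n)" by (simp add: apn algebra_simps np pn0 mult.assoc)
    finally show ?thesis .
  qed
  have pnn: "pos (n * n)" using pos_square[OF pos_adj[OF pn]] .
  have 1: "pos (- (adj y * y))" unfolding yy using pos_mult_commuting[OF pnn pn] by (simp add: mult.assoc)
  obtain b c where bc: "adj b = b" "adj c = c" "y = b + \<i> *\<^sub>C c" using cartesian_decomposition by blast
  have ay: "adj y = b - \<i> *\<^sub>C c" by (simp add: bc adj_add adj_cscale cscale_minus_left)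
  have "adj y * y + y * adj y = 2 *\<^sub>R (b * b) + 2 *\<^sub>R (c * c)"
    unfolding ay by (simp add: bc(3) algebra_simps cscale_mult_left cscale_mult_right cscale_diff_right
        cscale_add_right ii_ii_cscale scaleR_2)
  then have "y * adj y = 2 *\<^sub>R (b * b) + 2 *\<^sub>R (c * c) + (- (adj y * y))" by (simp add: algebra_simps)
  then have "pos (y * adj y)"
    using 1 bc pos_square by (metis pos_add pos_scaleR zero_le_numeral)
  then have "y = 0" using adj_mult_self_neg_imp_zero[OF 1] by blast
  then have "n * n * n = 0" using yy by simp
  then have "(n * n) * (n * n) = 0" by (metis mult.assoc mult_zero_left)
  then have "norm (n * n) = 0" using norm_square_selfadjoint[OF pos_adj[OF pnn]] by simp
  then have "n = 0" using norm_square_selfadjoint[OF pos_adj[OF pn]] by simp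
  then show ?thesis using p(1) apn by (simp add: a_def)
qed

lemma pos_conj: 
  assumes "pos a"
  shows "pos (adj x * a * x)"
proof -
  obtain b where b: "pos b" "b * b = a" using pos_sqrt[OF assms] by blast
  have "adj x * a * x = adj (b * x) * (b * x)" by (simp add: adj_mult pos_adj[OF b(1)] mult.assoc flip: b(2))
  then show ?thesis using pos_adj_mult_self by metis
qed

lemma pos_conj_pos: "pos a \<Longrightarrow> pos c \<Longrightarrow> pos (c * a * c)"
  using pos_conj[of a c] by (simp add: pos_adj)

lemma adj_mult_self_cle_norm: "adj x * x \<preceq> (norm x)\<^sup>2 *\<^sub>R 1"
  using cle_norm[OF pos_adj[OF pos_adj_mult_self[of x]]] unfolding cstar_identity .

lemma norm_le_if_adj_mult_self_cle:
  assumes "adj x * x \<preceq> t\<^sup>2 *\<^sub>R 1" "t \<ge> 0"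
  shows "norm x \<le> t"
proof -
  have "norm (adj x * x) \<le> t\<^sup>2"
    by (rule norm_pos_le_if_cle[OF pos_adj_mult_self assms(1)]) simp
  then have "(norm x)\<^sup>2 \<le> t\<^sup>2" by (simp only: cstar_identity)
  then show ?thesis using assms(2) by (rule power2_le_imp_le)
qed

text \<open>
With \<open>r = c\<^sup>-\<^sup>1\<^sup>/\<^sup>2\<close> and \<open>e = d\<^sup>1\<^sup>/\<^sup>2\<close>, conjugating \<open>d \<le> c\<close> by \<open>r\<close> gives \<open>(e r)\<^sup>* (e r) \<le> 1\<close>. The norm does not
change on passing to \<open>(e r)\<^sup>* = r e\<close>, so \<open>e r\<^sup>2 e = (r e)\<^sup>* (r e) \<le> 1\<close> as well.
\<close>

lemma sqrt_inverse_sqrt_cle_one: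
  assumes dc: "d \<preceq> c" and b: "pos b" "c * b = 1" "b * c = 1" and e: "pos e" "e * e = d"
  shows "e * b * e \<preceq> 1"
proof -
  obtain r where r: "pos r" "r * r = b" "\<And>x. x * b = b * x \<Longrightarrow> x * r = r * x" using pos_sqrt[OF b(1)] by blast
  have "c * r = r * c" using r(3) b by simp
  then have rcr: "r * c * r = 1" using b(2) r(2) by (metis mult.assoc)
  have "pos (r * (c - d) * r)" using pos_conj_pos[OF dc r(1)] .
  then have "adj (e * r) * (e * r) \<preceq> 1\<^sup>2 *\<^sub>R 1"
    using rcr by (simp add: adj_mult pos_adj r(1) e(1) algebra_simps flip: e(2))
  then have "norm (e * r) \<le> 1" by (rule norm_le_if_adj_mult_self_cle) simp
  moreover have "norm (r * e) = norm (e * r)" using norm_adj[of "e * r"] by (simp add: adj_mult pos_adj r(1) e(1))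
  ultimately have "(norm (r * e))\<^sup>2 \<le> 1" by (simp add: power_le_one)
  then have "pos (((norm (r * e))\<^sup>2 *\<^sub>R 1 - adj (r * e) * (r * e)) + (1 - (norm (r * e))\<^sup>2) *\<^sub>R 1)"
    by (intro pos_add adj_mult_self_cle_norm pos_scaleR_one) auto
  moreover have "adj (r * e) * (r * e) = e * b * e" by (simp add: adj_mult pos_adj r(1) e(1) mult.assoc flip: r(2))
  ultimately show ?thesis by (simp add: algebra_simps)
qed

lemma inverse_antimono:
  assumes dc: "d \<preceq> c" and d: "pos d" and b: "pos b" "c * b = 1" "b * c = 1" and a: "pos a" "d * a = 1" "a * d = 1"
  shows "b \<preceq> a"
proof -
  obtain e where e: "pos e" "e * e = d" using pos_sqrt[OF d] by blast
  have "pos (adj (e * a) * (1 - e * b * e) * (e * a))"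
    by (rule pos_conj[OF sqrt_inverse_sqrt_cle_one[OF dc b e]])
  moreover have "adj (e * a) * (1 - e * b * e) * (e * a) = a * (e * e) * a - (a * (e * e)) * b * ((e * e) * a)"
    by (simp add: adj_mult pos_adj e(1) a(1) algebra_simps)
  ultimately show ?thesis by (simp add: e(2) a)
qed

text \<open>
In \<open>z\<^sup>2 - r\<^sup>2 = (z - r) (z + r)\<close> the second factor can be divided out after a shift by \<open>e > 0\<close>
that makes it invertible.
\<close>

lemma cle_if_square_cle:
  fixes z r :: "'a::unital_cstar_algebra"
  assumes z: "pos z" and r: "pos r" and zr: "z * r = r * z" and sq: "r * r \<preceq> z * z"
  shows "r \<preceq> z"
proof (rule pos_if_approx)
  fix e :: real assume e: "e > 0"
  define c where "c = (z + r) + e *\<^sub>R 1"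
  obtain b where b: "pos b" "c * b = 1" "b * c = 1"
    using pos_shift_inverse[OF pos_add[OF z r] e] unfolding c_def by blast
  define w where "w = z - r + e *\<^sub>R 1"
  have wc: "w * c = (z * z - r * r) + (2 * e) *\<^sub>R z + (e * e) *\<^sub>R 1"
    by (simp add: w_def c_def algebra_simps zr scaleR_2 flip: scaleR_add_left)
  have "pos (w * c)" unfolding wc using sq z e by (intro pos_add pos_scaleR pos_scaleR_one) auto
  moreover have cw: "w * c = c * w" by (simp add: w_def c_def algebra_simps zr)
  then have "(w * c) * c = c * (w * c)" by (metis mult.assoc)
  then have "(w * c) * b = b * (w * c)" by (rule commutes_with_inverse[OF b(2,3)])
  ultimately have "pos ((w * c) * b)" using pos_mult_commuting[of "w * c" b] b(1) by blast
  then show "pos (z - r + e *\<^sub>R 1)" by (simp add: mult.assoc b(2)) (simp add: w_def)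
qed

text \<open>
If \<open>q = y\<^sub>+\<close> then \<open>2 q - y = \<bar>y\<bar>\<close>, and the claim becomes \<open>\<bar>y\<bar> \<le> 2 p - y\<close>. This may be checked on
squares, whose difference is \<open>4 p (p - y)\<close>.
\<close>

lemma pos_part_least:
  fixes y p q :: "'a::unital_cstar_algebra"
  assumes q: "pos q" "y \<preceq> q" "q * (q - y) = 0" "\<And>x. x * y = y * x \<Longrightarrow> x * q = q * x"
    and p: "pos p" "y \<preceq> p" "p * y = y * p"
  shows "q \<preceq> p"
proof -
  have yq: "y * q = q * y" and pq: "p * q = q * p" using q(4) p(3) by auto
  have qq: "q * q = q * y" using q(3) by (simp add: algebra_simps)
  have pp: "pos (p * (p - y))" using p by (intro pos_mult_commuting) (auto simp: algebra_simps)
  have "2 *\<^sub>R q - y \<preceq> 2 *\<^sub>R p - y"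
  proof (rule cle_if_square_cle)
    show "pos (2 *\<^sub>R p - y)" using pos_add[OF p(1,2)] by (simp add: scaleR_2 algebra_simps)
    show "pos (2 *\<^sub>R q - y)" using pos_add[OF q(1,2)] by (simp add: scaleR_2 algebra_simps)
    show "(2 *\<^sub>R p - y) * (2 *\<^sub>R q - y) = (2 *\<^sub>R q - y) * (2 *\<^sub>R p - y)"
      by (simp add: algebra_simps p(3) pq yq)
    have "(2 *\<^sub>R p - y) * (2 *\<^sub>R p - y) - (2 *\<^sub>R q - y) * (2 *\<^sub>R q - y) = 4 *\<^sub>R (p * (p - y))"
      by (simp add: algebra_simps p(3) yq qq flip: scaleR_add_left)
    then show "pos ((2 *\<^sub>R p - y) * (2 *\<^sub>R p - y) - (2 *\<^sub>R q - y) * (2 *\<^sub>R q - y))"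
      using pos_scaleR[OF pp, of 4] by simp
  qed
  then have "pos ((1/2) *\<^sub>R (2 *\<^sub>R p - y - (2 *\<^sub>R q - y)))" by (intro pos_scaleR) auto
  then show ?thesis by (simp add: algebra_simps)
qed

section \<open>Elementary completely positive maps\<close>

text \<open>
The maps \<open>x \<mapsto> \<Sum> a\<^sub>i\<^sup>* x a\<^sub>i\<close> without the normalisation \<open>\<Sum> a\<^sub>i\<^sup>* a\<^sub>i = 1\<close>, generated one summand at a
time, so that rule induction replaces the handling of finite families.
\<close>

inductive_set elementary_cp :: "('a::unital_cstar_algebra \<Rightarrow> 'a) set" where
  zero: "(\<lambda>x. 0) \<in> elementary_cp"
| step: "\<phi> \<in> elementary_cp \<Longrightarrow> (\<lambda>x. \<phi> x + adj a * x * a) \<in> elementary_cp"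

lemma elementary_cp_conj: "(\<lambda>x. adj a * x * a) \<in> elementary_cp"
  using elementary_cp.step[OF elementary_cp.zero, of a] by simp

lemma elementary_cp_add:
  assumes "\<theta> \<in> elementary_cp" "\<phi> \<in> elementary_cp"
  shows "(\<lambda>x. \<phi> x + \<theta> x) \<in> elementary_cp"
  using assms
proof (induction rule: elementary_cp.induct)
  case (step \<theta> a)
  then show ?case using elementary_cp.step[of "\<lambda>x. \<phi> x + \<theta> x" a] by (simp add: add.assoc)
qed simp

lemma elementary_cp_sum:
  "(\<And>i. i \<in> S \<Longrightarrow> \<phi> i \<in> elementary_cp) \<Longrightarrow> (\<lambda>x. \<Sum>i\<in>S. \<phi> i x) \<in> elementary_cp"
proof (induction S rule: infinite_finite_induct)
  case (insert i S)
  then show ?case using elementary_cp_add[of "\<lambda>x. \<Sum>i\<in>S. \<phi> i x" "\<phi> i"] by simp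
qed (auto intro: elementary_cp.zero)

lemma elementary_cp_conj_conj:
  assumes "\<phi> \<in> elementary_cp"
  shows "(\<lambda>x. adj b * \<phi> (adj c * x * c) * b) \<in> elementary_cp"
  using assms
proof (induction rule: elementary_cp.induct)
  case zero
  then show ?case by (simp add: elementary_cp.zero)
next
  case (step \<phi> a)
  then show ?case
    using elementary_cp.step[of "\<lambda>x. adj b * \<phi> (adj c * x * c) * b" "c * a * b"]
    by (simp add: algebra_simps adj_mult)
qed

lemma elementary_cp_linear:
  assumes "\<phi> \<in> elementary_cp"
  shows "\<phi> (x + y) = \<phi> x + \<phi> y" "\<phi> (x - y) = \<phi> x - \<phi> y" "\<phi> (r *\<^sub>R x) = r *\<^sub>R \<phi> x"
  using assms
  by (induction rule: elementary_cp.induct) (simp_all add: algebra_simps)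

lemma elementary_cp_pos: "\<phi> \<in> elementary_cp \<Longrightarrow> pos x \<Longrightarrow> pos (\<phi> x)"
  by (induction rule: elementary_cp.induct) (auto intro: pos_add pos_conj)

lemma elementary_cp_mono: "\<phi> \<in> elementary_cp \<Longrightarrow> x \<preceq> y \<Longrightarrow> \<phi> x \<preceq> \<phi> y"
  using elementary_cp_pos[of \<phi> "y - x"] by (simp add: elementary_cp_linear)

lemma elementary_cp_adj: "\<phi> \<in> elementary_cp \<Longrightarrow> \<phi> (adj x) = adj (\<phi> x)"
  by (induction rule: elementary_cp.induct) (simp_all add: adj_add adj_mult adj_adj mult.assoc)

text \<open>
A summand \<open>a\<close> contributes \<open>(x a - a z)\<^sup>* (x a - a z)\<close>. For a unital map and \<open>z = \<phi> x\<close> this is the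
Kadison-Schwarz inequality \<open>\<phi> (x)\<^sup>* \<phi> (x) \<le> \<phi> (x\<^sup>* x)\<close>. With \<open>z\<close> free, the induction goes through.
\<close>

lemma elementary_cp_Schwarz:
  assumes "\<phi> \<in> elementary_cp"
  shows "pos (\<phi> (adj x * x) - adj z * \<phi> x - adj (\<phi> x) * z + adj z * \<phi> 1 * z)"
  using assms
proof (induction rule: elementary_cp.induct)
  case (step \<phi> a)
  have "pos (\<phi> (adj x * x) - adj z * \<phi> x - adj (\<phi> x) * z + adj z * \<phi> 1 * z
      + adj (x * a - a * z) * (x * a - a * z))"
    using pos_add[OF step.IH pos_adj_mult_self] .
  then show ?case by (simp add: algebra_simps adj_diff adj_mult adj_add adj_adj)
qed simp

lemma elementary_cp_contractive:
  assumes "\<phi> \<in> elementary_cp" "\<phi> 1 = 1"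
  shows "norm (\<phi> x) \<le> norm x"
proof (rule norm_le_if_adj_mult_self_cle)
  have "adj (\<phi> x) * \<phi> x \<preceq> \<phi> (adj x * x)"
    using elementary_cp_Schwarz[OF assms(1), of x "\<phi> x"] by (simp add: assms(2))
  also have "\<phi> (adj x * x) \<preceq> \<phi> ((norm x)\<^sup>2 *\<^sub>R 1)"
    by (rule elementary_cp_mono[OF assms(1) adj_mult_self_cle_norm])
  finally show "adj (\<phi> x) * \<phi> x \<preceq> (norm x)\<^sup>2 *\<^sub>R 1"
    by (simp add: elementary_cp_linear[OF assms(1)] assms(2))
qed simp

lemma elementary_cp_in_ideal:
  "\<phi> \<in> elementary_cp \<Longrightarrow> cstar_ideal J \<Longrightarrow> x \<in> J \<Longrightarrow> \<phi> x \<in> J"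
  by (induction rule: elementary_cp.induct) (auto simp: cstar_ideal_def)

lemma elementary_cp_iff:
  "\<phi> \<in> elementary_cp \<longleftrightarrow> (\<exists>n (a::nat \<Rightarrow> _). \<phi> = (\<lambda>x. \<Sum>i<n. adj (a i) * x * a i))"
proof
  assume "\<phi> \<in> elementary_cp"
  then show "\<exists>n (a::nat \<Rightarrow> _). \<phi> = (\<lambda>x. \<Sum>i<n. adj (a i) * x * a i)"
  proof (induction rule: elementary_cp.induct)
    case zero
    show ?case by (rule exI[of _ 0]) simp
  next
    case (step \<phi> b)
    then obtain n and a :: "nat \<Rightarrow> 'a" where "\<phi> = (\<lambda>x. \<Sum>i<n. adj (a i) * x * a i)" by blast
    then show ?case by (intro exI[of _ "Suc n"] exI[of _ "a(n := b)"]) simp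
  qed
qed (auto intro: elementary_cp_sum elementary_cp_conj)

lemma elementary_ucp_iff: "(\<psi> :: 'a::unital_cstar_algebra \<Rightarrow> 'a) \<in> elementary_ucp \<longleftrightarrow> \<psi> \<in> elementary_cp \<and> \<psi> 1 = 1"
proof
  assume "\<psi> \<in> elementary_ucp"
  then obtain n and a :: "nat \<Rightarrow> 'a"
    where "(\<Sum>i<n. adj (a i) * a i) = 1" "\<psi> = (\<lambda>x. \<Sum>i<n. adj (a i) * x * a i)"
    unfolding elementary_ucp_def by blast
  then show "\<psi> \<in> elementary_cp \<and> \<psi> 1 = 1"
    by (auto intro: elementary_cp_sum elementary_cp_conj)
next
  assume "\<psi> \<in> elementary_cp \<and> \<psi> 1 = 1"
  moreover then obtain n and a :: "nat \<Rightarrow> 'a" where "\<psi> = (\<lambda>x. \<Sum>i<n. adj (a i) * x * a i)"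
    unfolding elementary_cp_iff by blast
  ultimately show "\<psi> \<in> elementary_ucp"
    unfolding elementary_ucp_def by (intro CollectI exI[of _ n] exI[of _ a]) simp
qed

lemma elementary_ucp_convex:
  assumes "\<phi> \<in> elementary_ucp" "\<psi> \<in> elementary_ucp" and t: "0 \<le> t" "t \<le> 1"
  shows "(\<lambda>x. (1 - t) *\<^sub>R \<phi> x + t *\<^sub>R \<psi> x) \<in> elementary_ucp"
proof -
  have sc: "(\<lambda>x. s *\<^sub>R \<theta> x) \<in> elementary_cp" if "s \<ge> 0" "\<theta> \<in> elementary_cp" for s and \<theta> :: "'a \<Rightarrow> 'a"
    using elementary_cp_conj_conj[OF that(2), of "sqrt s *\<^sub>R 1" 1] that(1) by (simp add: adj_scaleR)
  show ?thesis using assms unfolding elementary_ucp_iff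
    by (auto intro!: elementary_cp_add sc simp flip: scaleR_add_left)
qed

section \<open>States\<close>

lemma state_linear:
  assumes "state f"
  shows "f (x + y) = f x + f y" "f (x - y) = f x - f y" "f (r *\<^sub>R x) = r *\<^sub>R f x"
    "f (c *\<^sub>C x) = c * f x" "f (- x) = - f x" "f 0 = 0" "f (\<Sum>i\<in>S. g i) = (\<Sum>i\<in>S. f (g i))"
proof -
  have l: "linear f" and c: "\<And>c x. f (c *\<^sub>C x) = c * f x"
    using assms by (auto simp: state_def cdual_def bounded_linear.linear)
  show "f (x + y) = f x + f y" "f (x - y) = f x - f y" "f (r *\<^sub>R x) = r *\<^sub>R f x" "f (- x) = - f x"
    "f 0 = 0" "f (\<Sum>i\<in>S. g i) = (\<Sum>i\<in>S. f (g i))" "f (c *\<^sub>C x) = c * f x"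
    using l by (simp_all add: linear_add linear_diff linear_scale linear_neg linear_0 linear_sum c)
qed

lemma state_bounded_linear: "state f \<Longrightarrow> bounded_linear f"
  by (simp add: state_def cdual_def)

lemma state_norm_le: "state f \<Longrightarrow> norm (f x) \<le> norm x"
  using onorm[OF state_bounded_linear, of f x] by (simp add: state_def)

lemma state_pos:
  assumes "state f" "pos a"
  shows "0 \<le> Re (f a)" "Im (f a) = 0"
proof -
  obtain b where b: "pos b" "b * b = a" using pos_sqrt[OF assms(2)] by blast
  have "f (adj b * b) \<in> \<real>\<^sub>\<ge>\<^sub>0" using assms(1) by (simp add: state_def)
  then show "0 \<le> Re (f a)" "Im (f a) = 0" by (simp_all add: b pos_adj complex_nonneg_Reals_iff)
qed

lemma state_mono: "state f \<Longrightarrow> a \<preceq> b \<Longrightarrow> Re (f a) \<le> Re (f b)"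
  using state_pos(1)[of f "b - a"] by (simp add: state_linear)

lemma state_selfadjoint_real:
  assumes "state f" "adj a = a"
  shows "Im (f a) = 0"
proof -
  have "Im (f (norm a *\<^sub>R 1 - a)) = 0" using state_pos(2)[OF assms(1) cle_norm[OF assms(2)]] .
  moreover have "Im (f 1) = 0" using state_pos(2)[OF assms(1) pos_one] .
  ultimately show ?thesis by (simp add: state_linear[OF assms(1)])
qed

lemma state_adj:
  assumes "state f"
  shows "f (adj x) = cnj (f x)"
proof -
  obtain b c where bc: "adj b = b" "adj c = c" "x = b + \<i> *\<^sub>C c" using cartesian_decomposition by blast
  have "adj x = b - \<i> *\<^sub>C c" by (simp add: bc adj_add adj_cscale cscale_minus_left)
  then show ?thesis
    using state_selfadjoint_real[OF assms bc(1)] state_selfadjoint_real[OF assms bc(2)]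
    by (simp add: bc(3) state_linear[OF assms] complex_eq_iff)
qed

lemma state_Cauchy_Schwarz:
  assumes "state f"
  shows "(cmod (f (adj y * x)))\<^sup>2 \<le> Re (f (adj y * y)) * Re (f (adj x * x))"
proof -
  define \<alpha> where "\<alpha> = f (adj y * x)"
  define A B where "A = Re (f (adj x * x))" and "B = Re (f (adj y * y))"
  have A: "A \<ge> 0" and B: "B \<ge> 0"
    unfolding A_def B_def using state_pos(1)[OF assms] pos_adj_mult_self by blast+
  have f2: "f (adj x * y) = cnj \<alpha>" using state_adj[OF assms, of "adj y * x"] by (simp add: \<alpha>_def adj_mult adj_adj)
  have fB: "f (adj y * y) = complex_of_real B"
    using state_pos(2)[OF assms pos_adj_mult_self] by (simp add: B_def complex_eq_iff)
  have q: "0 \<le> A - 2 * t * (cmod \<alpha>)\<^sup>2 + t\<^sup>2 * (cmod \<alpha>)\<^sup>2 * B" for t :: real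
  proof -
    define s where "s = complex_of_real t * \<alpha>"
    have "0 \<le> Re (f (adj (x - s *\<^sub>C y) * (x - s *\<^sub>C y)))"
      using state_pos(1)[OF assms pos_adj_mult_self] .
    also have "adj (x - s *\<^sub>C y) * (x - s *\<^sub>C y) =
        adj x * x - s *\<^sub>C (adj x * y) - cnj s *\<^sub>C (adj y * x) + (cnj s * s) *\<^sub>C (adj y * y)"
      by (simp add: adj_diff adj_cscale algebra_simps cscale_mult_left cscale_mult_right cscale_cscale
          cscale_diff_right)
    also have "Re (f \<dots>) = A - Re (s * cnj \<alpha>) - Re (cnj s * \<alpha>) + Re (cnj s * s * B)"
      by (simp add: state_linear[OF assms] f2 fB A_def \<alpha>_def[symmetric])
    also have "\<dots> = A - 2 * t * (cmod \<alpha>)\<^sup>2 + t\<^sup>2 * (cmod \<alpha>)\<^sup>2 * B"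
      unfolding s_def cmod_power2 by (simp add: power2_eq_square algebra_simps)
    finally show ?thesis .
  qed
  have "(cmod \<alpha>)\<^sup>2 \<le> B * A"
  proof (cases "B = 0")
    case True
    have "\<alpha> = 0"
    proof (rule ccontr)
      assume "\<alpha> \<noteq> 0"
      then have "(cmod \<alpha>)\<^sup>2 > 0" by simp
      then show False using q[of "(A + 1) / (cmod \<alpha>)\<^sup>2"] True A by simp
    qed
    then show ?thesis using A B by simp
  next
    case False
    then have "B > 0" using B by simp
    then show ?thesis using q[of "1 / B"] by (simp add: field_simps power2_eq_square)
  qed
  then show ?thesis by (simp add: \<alpha>_def A_def B_def)
qed

text \<open>
Cauchy-Schwarz against \<open>1\<close> bounds the norm of a positive functional by its value at \<open>1\<close>.
\<close>

lemma state_one: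
  assumes "state f"
  shows "f 1 = 1"
proof -
  have i: "Im (f 1) = 0" and r: "0 \<le> Re (f 1)" using state_pos[OF assms pos_one] by auto
  have "norm (f x) \<le> Re (f 1) * norm x" for x
  proof (rule power2_le_imp_le)
    have "(norm (f x))\<^sup>2 \<le> Re (f 1) * Re (f (adj x * x))"
      using state_Cauchy_Schwarz[OF assms, of 1 x] by simp
    also have "\<dots> \<le> Re (f 1) * Re (f ((norm x)\<^sup>2 *\<^sub>R 1))"
      by (intro mult_left_mono state_mono[OF assms adj_mult_self_cle_norm] r)
    finally show "(norm (f x))\<^sup>2 \<le> (Re (f 1) * norm x)\<^sup>2"
      by (simp add: state_linear[OF assms] power2_eq_square algebra_simps)
  qed (use r in simp)
  then have "onorm f \<le> Re (f 1)" by (rule onorm_le)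
  then have "1 \<le> Re (f 1)" using assms by (simp add: state_def)
  moreover have "Re (f 1) \<le> 1" using state_norm_le[OF assms, of 1] complex_Re_le_cmod[of "f 1"] by simp
  ultimately show ?thesis using i by (simp add: complex_eq_iff)
qed

section \<open>Norms of states on ideals\<close>

text \<open>
Ideals that need not be norm closed; closure under scalars is multiplication by multiples of \<open>1\<close>.
\<close>

definition two_sided_ideal :: "'a::unital_cstar_algebra set \<Rightarrow> bool" where
  "two_sided_ideal I \<longleftrightarrow> 0 \<in> I \<and> (\<forall>x\<in>I. \<forall>y\<in>I. x + y \<in> I) \<and> (\<forall>a. \<forall>x\<in>I. a * x \<in> I \<and> x * a \<in> I)"

lemma two_sided_idealD:
  assumes "two_sided_ideal I"
  shows "0 \<in> I" "x \<in> I \<Longrightarrow> y \<in> I \<Longrightarrow> x + y \<in> I" "x \<in> I \<Longrightarrow> a * x \<in> I" "x \<in> I \<Longrightarrow> x * a \<in> I"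
    "x \<in> I \<Longrightarrow> r *\<^sub>R x \<in> I" "x \<in> I \<Longrightarrow> y \<in> I \<Longrightarrow> x - y \<in> I"
    "(\<And>i. i \<in> S \<Longrightarrow> g i \<in> I) \<Longrightarrow> sum g S \<in> I"
proof -
  show z: "0 \<in> I" and a: "x \<in> I \<Longrightarrow> y \<in> I \<Longrightarrow> x + y \<in> I" for x y
    using assms by (auto simp: two_sided_ideal_def)
  show m: "x \<in> I \<Longrightarrow> a * x \<in> I" "x \<in> I \<Longrightarrow> x * a \<in> I" for x a
    using assms by (auto simp: two_sided_ideal_def)
  show "x \<in> I \<Longrightarrow> r *\<^sub>R x \<in> I" for x r using m(1)[of x "r *\<^sub>R 1"] by simp
  show "x \<in> I \<Longrightarrow> y \<in> I \<Longrightarrow> x - y \<in> I" using a[of x "- y"] m(1)[of y "- 1"] by simp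
  show "(\<And>i. i \<in> S \<Longrightarrow> g i \<in> I) \<Longrightarrow> sum g S \<in> I"
    by (induction S rule: infinite_finite_induct) (auto intro: z a)
qed

lemma cstar_ideal_closure:
  fixes I :: "'a::unital_cstar_algebra set"
  assumes "two_sided_ideal I"
  shows "cstar_ideal (closure I)"
proof -
  note I = two_sided_idealD[OF assms]
  have cl: "l \<in> closure I" if "\<And>n. s n \<in> I" "s \<longlonglongrightarrow> l" for s :: "nat \<Rightarrow> 'a" and l
    using that unfolding closure_sequential by auto
  have m: "a * x \<in> closure I" "x * a \<in> closure I" if x: "x \<in> closure I" for a x
  proof -
    obtain u where u: "\<And>n. u n \<in> I" "u \<longlonglongrightarrow> x" using x unfolding closure_sequential by blast
    have "(\<lambda>n. a * u n) \<longlonglongrightarrow> a * x" "(\<lambda>n. u n * a) \<longlonglongrightarrow> x * a" by (intro tendsto_intros u)+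
    then show "a * x \<in> closure I" "x * a \<in> closure I"
      by (auto intro: cl I(3,4)[OF u(1)])
  qed
  have a: "x + y \<in> closure I" if x: "x \<in> closure I" "y \<in> closure I" for x y
  proof -
    obtain u v where u: "\<And>n. u n \<in> I" "u \<longlonglongrightarrow> x" and v: "\<And>n. v n \<in> I" "v \<longlonglongrightarrow> y"
      using x unfolding closure_sequential by blast
    have "(\<lambda>n. u n + v n) \<longlonglongrightarrow> x + y" by (intro tendsto_intros u v)
    then show ?thesis by (rule cl[rotated]) (intro I(2) u(1) v(1))
  qed
  have "c *\<^sub>C x \<in> closure I" if "x \<in> closure I" for c x
    using m(1)[OF that, of "c *\<^sub>C 1"] by (simp add: cscale_mult_left)
  moreover have "0 \<in> closure I" using I(1) closure_subset by blast
  ultimately show ?thesis unfolding cstar_ideal_def using m a by simp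
qed

lemma onorm_on_upper:
  assumes f: "bounded_linear f" and x: "x \<in> J"
  shows "norm (f x) / norm x \<le> onorm_on J f"
proof -
  have "norm (f y) / norm y \<le> onorm f" for y by (rule le_onorm[OF f])
  then have "bdd_above ((\<lambda>x. norm (f x) / norm x) ` J)" by (intro bdd_aboveI2)
  then show ?thesis
    unfolding onorm_on_def using cSUP_upper[OF x, of "\<lambda>x. norm (f x) / norm x"] by blast
qed

lemma norm_le_onorm_on:
  assumes f: "bounded_linear f" and x: "x \<in> J"
  shows "norm (f x) \<le> onorm_on J f * norm x"
  using onorm_on_upper[OF f x] f
  by (cases "x = 0") (simp_all add: divide_le_eq bounded_linear.linear linear_0)

lemma onorm_on_nonneg: "bounded_linear f \<Longrightarrow> 0 \<in> J \<Longrightarrow> 0 \<le> onorm_on J f"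
  using onorm_on_upper[of f 0 J] by simp

lemma onorm_on_le:
  assumes "x0 \<in> J" "0 \<le> c" "\<And>x. x \<in> J \<Longrightarrow> norm (f x) \<le> c * norm x"
  shows "onorm_on J f \<le> c"
  unfolding onorm_on_def
proof (rule cSUP_least)
  fix x assume "x \<in> J"
  then show "norm (f x) / norm x \<le> c" using assms(2,3) by (cases "norm x = 0") (simp_all add: divide_le_eq)
qed (use assms(1) in blast)

text \<open>
The inverse of \<open>a + 1\<close> for positive \<open>a\<close>. For \<open>a\<close> in an ideal, the elements \<open>1 - resolvent a\<close> form
an approximate unit of it: they increase with \<open>a\<close> and stay below \<open>1\<close>.
\<close>

definition resolvent :: "'a::unital_cstar_algebra \<Rightarrow> 'a" where
  "resolvent a = (SOME b. pos b \<and> (a + 1) * b = 1 \<and> b * (a + 1) = 1 \<and> b \<preceq> 1)"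

lemma resolvent:
  assumes "pos a"
  shows "pos (resolvent a)" "(a + 1) * resolvent a = 1" "resolvent a * (a + 1) = 1" "resolvent a \<preceq> 1"
proof -
  have "\<exists>b. pos b \<and> (a + 1) * b = 1 \<and> b * (a + 1) = 1 \<and> b \<preceq> 1"
    using pos_shift_inverse[OF assms zero_less_one] by (metis scaleR_one)
  from someI_ex[OF this]
  show "pos (resolvent a)" "(a + 1) * resolvent a = 1" "resolvent a * (a + 1) = 1" "resolvent a \<preceq> 1"
    unfolding resolvent_def by blast+
qed

lemma one_minus_resolvent: "pos a \<Longrightarrow> 1 - resolvent a = a * resolvent a"
  using resolvent(2)[of a] by (simp add: algebra_simps)

lemma resolvent_zero: "resolvent 0 = 1"
  using resolvent(2)[OF pos_zero] by simp

lemma resolvent_antimono: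
  assumes a: "pos a" and ac: "a \<preceq> c"
  shows "resolvent c \<preceq> resolvent a"
proof (rule inverse_antimono)
  have c: "pos c" using pos_add[OF a ac] by simp
  show "a + 1 \<preceq> c + 1" using ac by simp
  show "pos (a + 1)" using pos_add[OF a pos_one] .
  show "pos (resolvent c)" "(c + 1) * resolvent c = 1" "resolvent c * (c + 1) = 1" by (rule resolvent[OF c])+
  show "pos (resolvent a)" "(a + 1) * resolvent a = 1" "resolvent a * (a + 1) = 1" by (rule resolvent[OF a])+
qed

text \<open>
Take \<open>a = m (y\<^sup>* y + y y\<^sup>*)\<close> with \<open>m\<close> large and put \<open>b = (a + 1)\<^sup>-\<^sup>1\<close>, \<open>E = 1 - b\<close>. Then \<open>b y\<close> and \<open>y b\<close>
have norm at most \<open>1 / \<surd>m\<close>, so \<open>E y E\<close> is close to \<open>y\<close>. Multiplying by \<open>E\<close> on both sides matters: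
Cauchy-Schwarz gives \<open>\<bar>\<omega> (E y E)\<bar> \<le> \<omega> (E\<^sup>2) \<parallel>y\<parallel> \<le> \<omega> (E) \<parallel>y\<parallel>\<close>, whereas \<open>E y\<close> would only give the
square root of \<open>\<omega> (E)\<close>.
\<close>

lemma state_almost_bounded_by_approximate_unit:
  assumes \<omega>: "state \<omega>" and I: "two_sided_ideal I" and y: "y \<in> I" and e: "e > 0"
  obtains a where "a \<in> I" "pos a" "cmod (\<omega> y) \<le> Re (\<omega> (1 - resolvent a)) * norm y + e"
proof -
  note I = two_sided_idealD[OF I]
  define m where "m = (3 / e)\<^sup>2"
  have m: "m > 0" using e by (simp add: m_def)
  define w where "w = adj y * y + y * adj y"
  have wy: "pos (adj y * y)" "pos (y * adj y)"
    using pos_adj_mult_self[of y] pos_adj_mult_self[of "adj y"] by (simp_all add: adj_adj)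
  define a where "a = m *\<^sub>R w"
  have aI: "a \<in> I" unfolding a_def w_def using y by (intro I)
  have pa: "pos a" unfolding a_def w_def using m wy by (intro pos_scaleR pos_add) auto
  define b where "b = resolvent a"
  note b = resolvent[OF pa, folded b_def]
  note ab = pos_adj[OF b(1)]
  have bwb: "m *\<^sub>R (b * w * b) = b - b * b"
  proof -
    have "b * a * b + b * b = b" using b(2) by (metis distrib_left distrib_right mult.assoc mult_1_right)
    then show ?thesis by (simp add: a_def algebra_simps)
  qed
  have pbb: "pos (b * b)" using pos_square[OF ab] .
  have "pos ((1 / m) *\<^sub>R ((1 - b) + b * b))" using m b(4) pbb by (intro pos_scaleR pos_add) auto
  also have "(1 / m) *\<^sub>R ((1 - b) + b * b) = (1 / m) *\<^sub>R (1 - m *\<^sub>R (b * w * b))"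
    unfolding bwb by (simp add: algebra_simps)
  also have "\<dots> = (e / 3)\<^sup>2 *\<^sub>R 1 - b * w * b"
    using m by (simp add: scaleR_diff_right) (simp add: m_def power_divide)
  finally have bwb2: "b * w * b \<preceq> (e / 3)\<^sup>2 *\<^sub>R 1" .
  have nb: "norm (z * b) \<le> e / 3" if "adj z * z \<preceq> w" for z
  proof (rule norm_le_if_adj_mult_self_cle)
    have "adj (z * b) * (z * b) \<preceq> b * w * b"
      using pos_conj_pos[OF that b(1)] by (simp add: adj_mult ab algebra_simps)
    then show "adj (z * b) * (z * b) \<preceq> (e / 3)\<^sup>2 *\<^sub>R 1" using bwb2 cle_trans by blast
  qed (use e in simp)
  have n1: "norm (y * b) \<le> e / 3" by (rule nb) (use wy in \<open>simp add: w_def\<close>)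
  have "norm (adj y * b) \<le> e / 3" by (rule nb) (use wy in \<open>simp add: w_def adj_adj\<close>)
  then have n2: "norm (b * y) \<le> e / 3" using norm_adj[of "b * y"] by (simp add: adj_mult ab)
  have "norm b \<le> 1" using norm_pos_le_if_cle[OF b(1), of 1] b(4) by simp
  then have n3: "norm (b * (y * b)) \<le> e / 3"
    using n1 norm_mult_ineq[of b "y * b"] mult_right_mono[of "norm b" 1 "norm (y * b)"] by simp
  define E where "E = 1 - b"
  have pE: "pos E" unfolding E_def by (rule b(4))
  note aE = pos_adj[OF pE]
  define z where "z = b * y + y * b - b * (y * b)"
  have "norm z \<le> e"
    using norm_triangle_ineq4[of "b * y + y * b" "b * (y * b)"] norm_triangle_ineq[of "b * y" "y * b"]
      n1 n2 n3 unfolding z_def by linarith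
  then have "cmod (\<omega> z) \<le> e" using state_norm_le[OF \<omega>] order_trans by blast
  moreover have "y = E * (y * E) + z" by (simp add: E_def z_def algebra_simps)
  then have "\<omega> y = \<omega> (E * (y * E)) + \<omega> z" using state_linear(1)[OF \<omega>] by metis
  ultimately have "cmod (\<omega> y) \<le> cmod (\<omega> (E * (y * E))) + e"
    using norm_triangle_ineq[of "\<omega> (E * (y * E))" "\<omega> z"] by simp
  moreover have "cmod (\<omega> (E * (y * E))) \<le> Re (\<omega> E) * norm y"
  proof -
    have EE: "0 \<le> Re (\<omega> (E * E))" using state_pos(1)[OF \<omega> pos_square[OF aE]] .
    have yE: "adj (y * E) * (y * E) \<preceq> (norm y)\<^sup>2 *\<^sub>R (E * E)"
      using pos_conj_pos[OF adj_mult_self_cle_norm[of y] pE] by (simp add: adj_mult aE algebra_simps)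
    have "Re (\<omega> (adj (y * E) * (y * E))) \<le> (norm y)\<^sup>2 * Re (\<omega> (E * E))"
      using state_mono[OF \<omega> yE] by (simp add: state_linear(3)[OF \<omega>])
    then have "Re (\<omega> (E * E)) * Re (\<omega> (adj (y * E) * (y * E)))
        \<le> Re (\<omega> (E * E)) * ((norm y)\<^sup>2 * Re (\<omega> (E * E)))"
      by (rule mult_left_mono[OF _ EE])
    then have "(cmod (\<omega> (E * (y * E))))\<^sup>2 \<le> Re (\<omega> (E * E)) * ((norm y)\<^sup>2 * Re (\<omega> (E * E)))"
      using state_Cauchy_Schwarz[OF \<omega>, of E "y * E"] unfolding aE by (rule order_trans[rotated])
    also have "\<dots> = (norm y * Re (\<omega> (E * E)))\<^sup>2" by (simp add: power2_eq_square)
    finally have "cmod (\<omega> (E * (y * E))) \<le> norm y * Re (\<omega> (E * E))"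
      by (rule power2_le_imp_le) (use EE in simp)
    also have "\<dots> \<le> norm y * Re (\<omega> E)"
    proof (rule mult_left_mono[OF state_mono[OF \<omega>]])
      have "pos (E * b)" by (rule pos_mult_commuting[OF pE b(1)]) (simp add: E_def algebra_simps)
      then show "E * E \<preceq> E" by (simp add: E_def algebra_simps)
    qed simp
    finally show ?thesis by (simp only: mult.commute)
  qed
  ultimately have "cmod (\<omega> y) \<le> Re (\<omega> E) * norm y + e" by linarith
  then show ?thesis using that[OF aI pa] unfolding E_def b_def by blast
qed

lemma onorm_on_closure_le:
  assumes \<omega>: "state \<omega>" and I: "two_sided_ideal I"
    and c: "\<And>a. a \<in> I \<Longrightarrow> pos a \<Longrightarrow> Re (\<omega> (1 - resolvent a)) \<le> c"
  shows "onorm_on (closure I) \<omega> \<le> c"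
proof (rule onorm_on_le)
  show c0: "0 \<le> c" using c[OF two_sided_idealD(1)[OF I] pos_zero] by (simp add: resolvent_zero state_linear[OF \<omega>])
  show "0 \<in> closure I" using two_sided_idealD(1)[OF I] closure_subset by blast
  have bI: "cmod (\<omega> y) \<le> c * norm y" if y: "y \<in> I" for y
  proof (rule field_le_epsilon)
    fix e :: real assume "e > 0"
    then obtain a where "a \<in> I" "pos a" "cmod (\<omega> y) \<le> Re (\<omega> (1 - resolvent a)) * norm y + e"
      using state_almost_bounded_by_approximate_unit[OF \<omega> I y] by blast
    then show "cmod (\<omega> y) \<le> c * norm y + e"
      using mult_right_mono[OF c, of a "norm y"] by simp
  qed
  have "closed {x. cmod (\<omega> x) \<le> c * norm x}"
    by (intro closed_Collect_le continuous_intros linear_continuous_on state_bounded_linear \<omega>)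
  then have "closure I \<subseteq> {x. cmod (\<omega> x) \<le> c * norm x}" using bI by (intro closure_minimal) auto
  then show "cmod (\<omega> x) \<le> c * norm x" if "x \<in> closure I" for x using that by blast
qed

lemma approximate_unit_dominates:
  assumes \<omega>: "state \<omega>" and \<rho>: "state \<rho>" and I: "two_sided_ideal I"
    and le: "onorm_on (closure I) \<rho> \<le> onorm_on (closure I) \<omega>"
    and f: "f \<in> I" "pos f" "f \<preceq> 1" and e: "e > 0"
  obtains a where "a \<in> I" "pos a" "Re (\<rho> f) - e \<le> Re (\<omega> (1 - resolvent a))"
proof (rule ccontr)
  assume "\<not> thesis"
  then have "\<And>a. a \<in> I \<Longrightarrow> pos a \<Longrightarrow> Re (\<omega> (1 - resolvent a)) \<le> Re (\<rho> f) - e"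
    using that by (meson linorder_le_cases)
  then have "onorm_on (closure I) \<omega> \<le> Re (\<rho> f) - e" by (rule onorm_on_closure_le[OF \<omega> I])
  moreover have "Re (\<rho> f) \<le> onorm_on (closure I) \<rho>"
  proof -
    have "norm f \<le> 1" using norm_pos_le_if_cle[OF f(2), of 1] f(3) by simp
    moreover have "0 \<le> onorm_on (closure I) \<rho>"
      using two_sided_idealD(1)[OF I] closure_subset by (intro onorm_on_nonneg state_bounded_linear \<rho>) blast
    moreover have "cmod (\<rho> f) \<le> onorm_on (closure I) \<rho> * norm f"
      using f(1) closure_subset by (intro norm_le_onorm_on state_bounded_linear \<rho>) blast
    ultimately show ?thesis
      using complex_Re_le_cmod[of "\<rho> f"] mult_left_mono[of "norm f" 1 "onorm_on (closure I) \<rho>"] by simp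
  qed
  ultimately show False using le e by simp
qed

section \<open>Elements of an ideal as values of elementary maps\<close>

text \<open>
The algebraic two-sided ideal generated by \<open>g\<close>, that is, the finite sums of elements \<open>x g y\<close>.
\<close>

inductive_set ideal_gen :: "'a::unital_cstar_algebra \<Rightarrow> 'a set" for g where
  zero: "0 \<in> ideal_gen g"
| step: "z \<in> ideal_gen g \<Longrightarrow> z + x * g * y \<in> ideal_gen g"

lemma ideal_gen_self: "g \<in> ideal_gen g"
  using ideal_gen.step[OF ideal_gen.zero[of g], of 1 1] by simp

lemma two_sided_ideal_ideal_gen: "two_sided_ideal (ideal_gen g)"
proof -
  have a: "u + v \<in> ideal_gen g" if "v \<in> ideal_gen g" "u \<in> ideal_gen g" for u v
    using that
    by (induction rule: ideal_gen.induct) (auto simp: add.assoc[symmetric] intro: ideal_gen.step)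
  have m: "a * u \<in> ideal_gen g \<and> u * a \<in> ideal_gen g" if "u \<in> ideal_gen g" for a u
    using that
  proof (induction rule: ideal_gen.induct)
    case (step z x y)
    then show ?case
      using ideal_gen.step[of "a * z" g "a * x" y] ideal_gen.step[of "z * a" g x "y * a"]
      by (simp add: distrib_left distrib_right mult.assoc)
  qed (simp add: ideal_gen.zero)
  show ?thesis unfolding two_sided_ideal_def using a m ideal_gen.zero by blast
qed

lemma ideal_gen_subset:
  assumes "h \<in> ideal_gen g"
  shows "ideal_gen h \<subseteq> ideal_gen g"
proof
  note I = two_sided_idealD[OF two_sided_ideal_ideal_gen[of g]]
  fix z assume "z \<in> ideal_gen h"
  then show "z \<in> ideal_gen g" by (induction rule: ideal_gen.induct) (auto intro: I assms)
qed

text \<open>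
Polarisation: \<open>x g y + (x g y)\<^sup>* \<le> x g x\<^sup>* + y\<^sup>* g y\<close>, because the difference is
\<open>(x\<^sup>* - y)\<^sup>* g (x\<^sup>* - y)\<close>.
\<close>

lemma ideal_gen_dominated:
  assumes "z \<in> ideal_gen g" "pos g"
  obtains \<phi> where "\<phi> \<in> elementary_cp" "z + adj z \<preceq> \<phi> g"
proof -
  have "\<exists>\<phi>\<in>elementary_cp. z + adj z \<preceq> \<phi> g"
    using assms(1)
  proof (induction rule: ideal_gen.induct)
    case zero
    show ?case by (rule bexI[OF _ elementary_cp.zero]) simp
  next
    case (step z x y)
    then obtain \<phi> where \<phi>: "\<phi> \<in> elementary_cp" "z + adj z \<preceq> \<phi> g" by blast
    define \<theta> where "\<theta> u = \<phi> u + adj (adj x) * u * adj x + adj y * u * y" for u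
    have "\<theta> \<in> elementary_cp" unfolding \<theta>_def by (intro elementary_cp.step \<phi>)
    moreover have "\<theta> g - (z + x * g * y + adj (z + x * g * y)) =
        (\<phi> g - (z + adj z)) + adj (adj x - y) * g * (adj x - y)"
      by (simp add: \<theta>_def adj_add adj_mult adj_diff adj_adj pos_adj[OF assms(2)] algebra_simps)
    ultimately show ?case using pos_add[OF \<phi>(2) pos_conj[OF assms(2)]] by metis
  qed
  then show ?thesis using that by blast
qed

text \<open>
The hypothesis on \<open>t\<close> says that \<open>h \<ge> t\<close> where \<open>g\<close> lives; the case of interest is \<open>g = (h - t)\<^sub>+\<close>.
Choose an elementary map \<open>\<Phi>\<close> with \<open>s = \<Phi> g \<ge> d\<close> and let
\<open>\<phi> x = d\<^sup>1\<^sup>/\<^sup>2 (s + \<delta>)\<^sup>-\<^sup>1\<^sup>/\<^sup>2 \<Phi> (g\<^sup>1\<^sup>/\<^sup>2 x g\<^sup>1\<^sup>/\<^sup>2) (s + \<delta>)\<^sup>-\<^sup>1\<^sup>/\<^sup>2 d\<^sup>1\<^sup>/\<^sup>2\<close>. Since \<open>s (s + \<delta>)\<^sup>-\<^sup>1 = 1 - \<delta> (s + \<delta>)\<^sup>-\<^sup>1\<close>,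
the value \<open>\<phi> 1\<close> is \<open>d - \<delta> d\<^sup>1\<^sup>/\<^sup>2 (s + \<delta>)\<^sup>-\<^sup>1 d\<^sup>1\<^sup>/\<^sup>2\<close>, and \<open>d \<le> s + \<delta>\<close> bounds the error by \<open>\<delta>\<close>.
\<close>

lemma ideal_gen_approximated_by_value_at_one:
  assumes g: "pos g" and gh: "h * g = g * h" and t: "t *\<^sub>R g \<preceq> g * h"
    and d: "d \<in> ideal_gen g" "pos d" and \<delta>: "\<delta> > 0"
  obtains \<phi> where "\<phi> \<in> elementary_cp" "\<phi> 1 \<preceq> d" "d - \<delta> *\<^sub>R 1 \<preceq> \<phi> 1" "t *\<^sub>R \<phi> 1 \<preceq> \<phi> h"
proof -
  obtain \<Phi> where \<Phi>: "\<Phi> \<in> elementary_cp" "d + adj d \<preceq> \<Phi> g" using ideal_gen_dominated[OF d(1) g] by blast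
  define s where "s = \<Phi> g"
  have ps: "pos s" unfolding s_def by (rule elementary_cp_pos[OF \<Phi>(1) g])
  define c where "c = s + \<delta> *\<^sub>R 1"
  obtain b where b: "pos b" "c * b = 1" "b * c = 1"
    using pos_shift_inverse[OF ps \<delta>] unfolding c_def by blast
  obtain r where r: "pos r" "r * r = b" "\<And>x. x * b = b * x \<Longrightarrow> x * r = r * x" using pos_sqrt[OF b(1)] by blast
  obtain e where e: "pos e" "e * e = d" using pos_sqrt[OF d(2)] by blast
  obtain k where k: "pos k" "k * k = g" "\<And>x. x * g = g * x \<Longrightarrow> x * k = k * x" using pos_sqrt[OF g] by blast
  define \<phi> where "\<phi> x = adj (r * e) * \<Phi> (adj k * x * k) * (r * e)" for x
  have "s * b + \<delta> *\<^sub>R b = b * s + \<delta> *\<^sub>R b" using b(2,3) by (simp add: c_def algebra_simps)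
  then have "s * b = b * s" by simp
  then have sr: "s * r = r * s" by (rule r(3))
  have "s * b = 1 - \<delta> *\<^sub>R b" using b(2) by (simp add: c_def algebra_simps)
  then have rsr: "r * s * r = 1 - \<delta> *\<^sub>R b" using sr r(2) by (metis mult.assoc)
  have \<phi>: "\<phi> \<in> elementary_cp" unfolding \<phi>_def by (rule elementary_cp_conj_conj[OF \<Phi>(1)])
  have "\<phi> 1 = e * (r * s * r) * e"
    by (simp add: \<phi>_def adj_mult pos_adj e(1) r(1) k(1,2) s_def mult.assoc)
  then have \<phi>1: "\<phi> 1 = d - \<delta> *\<^sub>R (e * b * e)" unfolding rsr by (simp add: algebra_simps e(2))
  have "pos ((s - (d + adj d)) + d + \<delta> *\<^sub>R 1)"
    using \<Phi>(2) d(2) \<delta> unfolding s_def by (intro pos_add pos_scaleR_one) auto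
  then have "d \<preceq> c" by (simp add: c_def pos_adj[OF d(2)] algebra_simps)
  then have ebe: "e * b * e \<preceq> 1" by (rule sqrt_inverse_sqrt_cle_one[OF _ b e])
  show ?thesis
  proof
    show "\<phi> \<in> elementary_cp" by (rule \<phi>)
    show "\<phi> 1 \<preceq> d" unfolding \<phi>1 using \<delta> by (simp add: pos_scaleR pos_conj_pos b(1) e(1))
    show "d - \<delta> *\<^sub>R 1 \<preceq> \<phi> 1" unfolding \<phi>1 using pos_scaleR[OF ebe, of \<delta>] \<delta> by (simp add: algebra_simps)
    have "h * k = k * h" by (rule k(3)[OF gh])
    then have "adj k * (h - t *\<^sub>R 1) * k = g * h - t *\<^sub>R g"
      by (simp add: pos_adj[OF k(1)] algebra_simps flip: k(2))
    then have "pos (\<Phi> (adj k * (h - t *\<^sub>R 1) * k))" using t elementary_cp_pos[OF \<Phi>(1)] by simp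
    then have "pos (\<phi> (h - t *\<^sub>R 1))" unfolding \<phi>_def by (rule pos_conj)
    then show "t *\<^sub>R \<phi> 1 \<preceq> \<phi> h" by (simp add: elementary_cp_linear[OF \<phi>])
  qed
qed

section \<open>The main estimate\<close>

text \<open>
Here \<open>p = (h - s)\<^sub>+\<close> and \<open>q = (h - t)\<^sub>+\<close>. Since \<open>0 \<le> q \<le> p\<close>, the negative part \<open>n\<close> of \<open>h - s\<close> is
orthogonal to \<open>q\<close> as well as to \<open>p\<close>. So \<open>q p = q (h - s) = q (q + (t - s))\<close>, and the last factor
is invertible.
\<close>

lemma pos_part_shift_in_ideal_gen:
  fixes h p q :: "'a::unital_cstar_algebra"
  assumes p: "pos p" "h - s *\<^sub>R 1 \<preceq> p" "p * (p - (h - s *\<^sub>R 1)) = 0" "\<And>x. x * h = h * x \<Longrightarrow> x * p = p * x"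
    and q: "pos q" "q * (q - (h - t *\<^sub>R 1)) = 0" "\<And>x. x * h = h * x \<Longrightarrow> x * q = q * x"
    and qp: "q \<preceq> p" and st: "s < t"
  shows "q \<in> ideal_gen p"
proof -
  define n where "n = p - (h - s *\<^sub>R 1)"
  have n: "pos n" using p(2) by (simp add: n_def)
  have hp: "h * p = p * h" and hq: "h * q = q * h" using p(4) q(3) by auto
  have pq: "p * q = q * p" using q(3)[of p] hp by simp
  have "pos ((p - q) * n)"
    by (rule pos_mult_commuting[OF qp n]) (simp add: n_def algebra_simps hp hq pq)
  moreover have "(p - q) * n = - (q * n)" using p(3) by (simp add: n_def left_diff_distrib)
  moreover have "pos (q * n)"
    by (rule pos_mult_commuting[OF q(1) n]) (simp add: n_def algebra_simps hq pq)
  ultimately have "q * n = 0" using pos_antisym by metis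
  then have qp: "q * p = q * (q + (t - s) *\<^sub>R 1)"
    using q(2) by (simp add: n_def algebra_simps)
  obtain b where b: "(q + (t - s) *\<^sub>R 1) * b = 1"
    using pos_shift_inverse[OF q(1), of "t - s"] st by auto
  have "q = q * p * b" unfolding qp using b by (simp add: mult.assoc)
  moreover have "q * p * b \<in> ideal_gen p"
    by (intro two_sided_idealD[OF two_sided_ideal_ideal_gen] ideal_gen_self)
  ultimately show ?thesis by simp
qed

lemma sum_by_parts_telescope:
  fixes E :: "nat \<Rightarrow> real"
  shows "(\<Sum>k<n. real k * (E k - E (Suc k))) = (\<Sum>k<n. E k) - E 0 + E n - real n * E n"
  by (induction n) (auto simp: algebra_simps)

text \<open>
The layer argument. In the notation of the introduction, \<open>y k = h - k/N\<close>, \<open>\<tau> k = k/N\<close>, and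
\<open>S k\<close> is the sum of the \<open>a\<^sub>j\<close> with \<open>j \<ge> k\<close>. The error \<open>\<epsilon>\<close> is split into three parts: the loss in
choosing \<open>a\<^sub>k\<close>, the \<open>1/N\<close> from partial summation, and the total loss \<open>N \<delta>\<close> in approximating the
\<open>d\<^sub>k\<close>.
\<close>

lemma elementary_ucp_almost_dominates_unit_interval:
  fixes h :: "'a::unital_cstar_algebra"
  assumes \<omega>: "state \<omega>" and \<rho>: "state \<rho>"
    and le: "\<And>J. cstar_ideal J \<Longrightarrow> onorm_on J \<rho> \<le> onorm_on J \<omega>"
    and h: "pos h" "h \<preceq> 1" and \<epsilon>: "\<epsilon> > 0"
  obtains \<psi> where "\<psi> \<in> elementary_ucp" "Re (\<rho> h) - \<epsilon> \<le> Re (\<omega> (\<psi> h))"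
proof -
  obtain N where N: "0 < N" "inverse (real N) < \<epsilon> / 3"
    using ex_inverse_of_nat_less[of "\<epsilon> / 3"] \<epsilon> by auto
  define \<tau> where "\<tau> k = real k / real N" for k
  define y where "y k = h - \<tau> k *\<^sub>R 1" for k
  have ay: "adj (y k) = y k" for k by (simp add: y_def adj_diff adj_scaleR pos_adj[OF h(1)])
  have hy: "x * y k = y k * x \<longleftrightarrow> x * h = h * x" for x k by (simp add: y_def algebra_simps)
  have "\<forall>k. \<exists>p. pos p \<and> y k \<preceq> p \<and> p * (p - y k) = 0 \<and> (\<forall>x. x * h = h * x \<longrightarrow> x * p = p * x)"
    using pos_part[OF ay] unfolding hy by metis
  then obtain p where p: "\<And>k. pos (p k)" "\<And>k. y k \<preceq> p k" "\<And>k. p k * (p k - y k) = 0"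
    "\<And>k x. x * h = h * x \<Longrightarrow> x * p k = p k * x" by metis
  have hp: "h * p k = p k * h" for k using p(4) by simp
  have least: "p k \<preceq> q" if "pos q" "y k \<preceq> q" "q * h = h * q" for k q
    using pos_part_least[OF p(1) p(2) p(3) _ that(1,2)] p(4) that(3) unfolding hy by blast
  have \<tau>Suc: "\<tau> (Suc k) = \<tau> k + 1 / real N" for k by (simp add: \<tau>_def add_divide_distrib)
  have p0: "p 0 = h"
  proof -
    have "p 0 \<preceq> h" by (rule least) (simp_all add: h y_def \<tau>_def)
    moreover have "h \<preceq> p 0" using p(2)[of 0] by (simp add: y_def \<tau>_def)
    ultimately show ?thesis using pos_antisym[of "p 0 - h"] by simp
  qed
  have pN: "p N = 0"
  proof -
    have "p N \<preceq> 0" by (rule least) (use h(2) N in \<open>simp_all add: y_def \<tau>_def\<close>)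
    then show ?thesis using pos_antisym[OF p(1)] by simp
  qed
  have decr: "p (Suc k) \<preceq> p k" for k
  proof (rule least)
    have "pos ((p k - y k) + (1 / real N) *\<^sub>R 1)" by (intro pos_add pos_scaleR_one p) simp
    then show "y (Suc k) \<preceq> p k" by (simp add: y_def \<tau>Suc algebra_simps)
  qed (simp_all add: p(1) hp)
  have decr2: "p k \<preceq> p (Suc k) + (1 / real N) *\<^sub>R 1" for k
  proof (rule least)
    show "pos (p (Suc k) + (1 / real N) *\<^sub>R 1)" by (intro pos_add pos_scaleR_one p) simp
    show "y k \<preceq> p (Suc k) + (1 / real N) *\<^sub>R 1" using p(2)[of "Suc k"] by (simp add: y_def \<tau>Suc algebra_simps)
  qed (simp add: algebra_simps hp)
  define I where "I k = ideal_gen (p k)" for k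
  have ideal: "two_sided_ideal (I k)" for k unfolding I_def by (rule two_sided_ideal_ideal_gen)
  note I = two_sided_idealD[OF ideal]
  have "p (Suc k) \<in> I k" for k
    unfolding I_def
  proof (rule pos_part_shift_in_ideal_gen[OF p(1) _ _ p(4) p(1) _ p(4) decr])
    show "\<tau> k < \<tau> (Suc k)" using N(1) by (simp add: \<tau>Suc)
  qed (use p(2,3) in \<open>simp_all only: y_def\<close>)
  then have "I (Suc k) \<subseteq> I k" for k unfolding I_def by (rule ideal_gen_subset)
  then have Imono: "I j \<subseteq> I k" if "k \<le> j" for j k using that by (rule lift_Suc_antimono_le)
  have pI: "p j \<in> I k" if "k \<le> j" for j k using Imono[OF that] ideal_gen_self[of "p j"] by (auto simp: I_def)
  define f where "f k = real N *\<^sub>R (p k - p (Suc k))" for k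
  have f: "f k \<in> I k" "pos (f k)" "f k \<preceq> 1" for k
  proof -
    show "f k \<in> I k" unfolding f_def by (intro I pI) auto
    show "pos (f k)" unfolding f_def by (intro pos_scaleR decr) simp
    have "pos (real N *\<^sub>R (p (Suc k) + (1 / real N) *\<^sub>R 1 - p k))" by (intro pos_scaleR decr2) simp
    then show "f k \<preceq> 1" using N(1) by (simp add: f_def algebra_simps)
  qed
  have "\<exists>a. a \<in> I k \<and> pos a \<and> Re (\<rho> (f k)) - \<epsilon> / 3 \<le> Re (\<omega> (1 - resolvent a))" for k
  proof -
    have "\<epsilon> / 3 > 0" using \<epsilon> by simp
    from approximate_unit_dominates[OF \<omega> \<rho> ideal le[OF cstar_ideal_closure[OF ideal]] f this]
    show ?thesis by blast
  qed
  then obtain a where a: "\<And>k. a k \<in> I k" "\<And>k. pos (a k)"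
    "\<And>k. Re (\<rho> (f k)) - \<epsilon> / 3 \<le> Re (\<omega> (1 - resolvent (a k)))" by metis
  define S where "S k = (\<Sum>j=k..<N. a j)" for k
  have S: "pos (S k)" for k unfolding S_def by (intro pos_sum a)
  have SI: "S j \<in> I k" if "k \<le> j" for j k
    unfolding S_def
  proof (rule I(7))
    fix i assume "i \<in> {j..<N}"
    then have "k \<le> i" using that by simp
    then show "a i \<in> I k" using Imono a(1) by blast
  qed
  have S_Suc: "S k = a k + S (Suc k)" if "k < N" for k
    unfolding S_def by (rule sum.atLeast_Suc_lessThan[OF that])
  define e where "e k = 1 - resolvent (S k)" for k
  have eN: "e N = 0" by (simp add: e_def S_def resolvent_zero)
  have eI: "e j \<in> I k" if "k \<le> j" for j k
    unfolding e_def one_minus_resolvent[OF S] by (rule I(4)[OF SI[OF that]])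
  have e1: "e k \<preceq> 1" for k unfolding e_def using resolvent(1)[OF S] by simp
  define d where "d k = e k - e (Suc k)" for k
  have dI: "d k \<in> I k" for k unfolding d_def by (rule I(6)) (auto intro: eI)
  have d: "pos (d k)" if "k < N" for k
  proof -
    have "resolvent (S k) \<preceq> resolvent (S (Suc k))"
      by (rule resolvent_antimono[OF S]) (simp add: S_Suc[OF that] a(2))
    then show ?thesis by (simp add: d_def e_def)
  qed
  have \<omega>e: "Re (\<rho> (f k)) - \<epsilon> / 3 \<le> Re (\<omega> (e k))" if "k < N" for k
  proof -
    have "resolvent (S k) \<preceq> resolvent (a k)"
      by (rule resolvent_antimono[OF a(2)]) (simp add: S_Suc[OF that] S)
    then have "1 - resolvent (a k) \<preceq> e k" by (simp add: e_def)
    then show ?thesis using state_mono[OF \<omega>] a(3)[of k] order_trans by blast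
  qed
  define \<delta> where "\<delta> = \<epsilon> / (3 * real N)"
  have \<delta>: "\<delta> > 0" using \<epsilon> N by (simp add: \<delta>_def)
  have "\<exists>\<phi>. \<phi> \<in> elementary_cp \<and> \<phi> 1 \<preceq> d k \<and> d k - \<delta> *\<^sub>R 1 \<preceq> \<phi> 1 \<and> \<tau> k *\<^sub>R \<phi> 1 \<preceq> \<phi> h" if "k < N" for k
  proof -
    have "p k * h - \<tau> k *\<^sub>R p k = p k * p k" using p(3)[of k] by (simp add: y_def algebra_simps)
    then have "\<tau> k *\<^sub>R p k \<preceq> p k * h" using pos_square[OF pos_adj[OF p(1)]] by simp
    from ideal_gen_approximated_by_value_at_one[OF p(1) hp this _ d[OF that] \<delta>] dI[of k]
    show ?thesis unfolding I_def by blast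
  qed
  then obtain \<phi> where \<phi>: "\<And>k. k < N \<Longrightarrow> \<phi> k \<in> elementary_cp" "\<And>k. k < N \<Longrightarrow> \<phi> k 1 \<preceq> d k"
    "\<And>k. k < N \<Longrightarrow> d k - \<delta> *\<^sub>R 1 \<preceq> \<phi> k 1" "\<And>k. k < N \<Longrightarrow> \<tau> k *\<^sub>R \<phi> k 1 \<preceq> \<phi> k h" by metis
  \<comment> \<open>\<open>\<Phi> 1\<close> is at most the telescoping sum \<open>e 0 \<le> 1\<close> of the \<open>d k\<close>, which leaves room for the summand that makes the map unital\<close>
  define \<Phi> where "\<Phi> x = (\<Sum>k<N. \<phi> k x)" for x
  have \<Phi>: "\<Phi> \<in> elementary_cp" unfolding \<Phi>_def by (intro elementary_cp_sum \<phi>) simp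
  have "\<Phi> 1 \<preceq> (\<Sum>k<N. d k)"
    unfolding \<Phi>_def sum_subtractf[symmetric] by (intro pos_sum \<phi>) simp
  also have "(\<Sum>k<N. d k) = e 0" unfolding d_def sum_lessThan_telescope' by (simp add: eN)
  also have "e 0 \<preceq> 1" by (rule e1)
  finally obtain r where r: "pos r" "r * r = 1 - \<Phi> 1" using pos_sqrt by metis
  define \<psi> where "\<psi> x = \<Phi> x + adj r * x * r" for x
  have "\<psi> \<in> elementary_cp" unfolding \<psi>_def by (intro elementary_cp.step \<Phi>)
  then have "\<psi> \<in> elementary_ucp"
    unfolding elementary_ucp_iff by (simp add: \<psi>_def pos_adj[OF r(1)] r(2))
  moreover have "Re (\<rho> h) - \<epsilon> \<le> Re (\<omega> (\<psi> h))"
  proof -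
    have "\<tau> k * (Re (\<omega> (e k)) - Re (\<omega> (e (Suc k)))) - \<delta> \<le> Re (\<omega> (\<phi> k h))" if "k < N" for k
    proof -
      have \<tau>: "0 \<le> \<tau> k" "\<tau> k \<le> 1" using that by (auto simp: \<tau>_def)
      have "Re (\<omega> (d k - \<delta> *\<^sub>R 1)) \<le> Re (\<omega> (\<phi> k 1))" by (rule state_mono[OF \<omega> \<phi>(3)[OF that]])
      then have "Re (\<omega> (e k)) - Re (\<omega> (e (Suc k))) - \<delta> \<le> Re (\<omega> (\<phi> k 1))"
        by (simp add: d_def state_linear[OF \<omega>] state_one[OF \<omega>])
      from mult_left_mono[OF this \<tau>(1)]
      have "\<tau> k * (Re (\<omega> (e k)) - Re (\<omega> (e (Suc k)))) - \<tau> k * \<delta> \<le> \<tau> k * Re (\<omega> (\<phi> k 1))"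
        by (simp add: right_diff_distrib)
      moreover have "\<tau> k * Re (\<omega> (\<phi> k 1)) \<le> Re (\<omega> (\<phi> k h))"
        using state_mono[OF \<omega> \<phi>(4)[OF that]] by (simp add: state_linear(3)[OF \<omega>])
      moreover have "\<tau> k * \<delta> \<le> 1 * \<delta>" by (rule mult_right_mono) (use \<tau> \<delta> in auto)
      ultimately show ?thesis by linarith
    qed
    then have "(\<Sum>k<N. \<tau> k * (Re (\<omega> (e k)) - Re (\<omega> (e (Suc k)))) - \<delta>) \<le> (\<Sum>k<N. Re (\<omega> (\<phi> k h)))"
      by (intro sum_mono) simp
    also have "\<dots> = Re (\<omega> (\<Phi> h))" by (simp add: \<Phi>_def state_linear(7)[OF \<omega>])
    also have "\<dots> \<le> Re (\<omega> (\<psi> h))"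
      by (rule state_mono[OF \<omega>]) (simp add: \<psi>_def pos_conj[OF h(1)])
    finally have 1: "(\<Sum>k<N. \<tau> k * (Re (\<omega> (e k)) - Re (\<omega> (e (Suc k))))) - real N * \<delta> \<le> Re (\<omega> (\<psi> h))"
      by (simp add: sum_subtractf)
    have "(\<Sum>k<N. \<tau> k * (Re (\<omega> (e k)) - Re (\<omega> (e (Suc k))))) =
        (\<Sum>k<N. real k * (Re (\<omega> (e k)) - Re (\<omega> (e (Suc k))))) / real N"
      by (simp add: \<tau>_def sum_divide_distrib)
    also have "(\<Sum>k<N. real k * (Re (\<omega> (e k)) - Re (\<omega> (e (Suc k))))) = (\<Sum>k<N. Re (\<omega> (e k))) - Re (\<omega> (e 0))"
      using sum_by_parts_telescope[where E = "\<lambda>k. Re (\<omega> (e k))" and n = N]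
      by (simp add: eN state_linear(6)[OF \<omega>])
    finally have 2: "(\<Sum>k<N. \<tau> k * (Re (\<omega> (e k)) - Re (\<omega> (e (Suc k))))) =
        ((\<Sum>k<N. Re (\<omega> (e k))) - Re (\<omega> (e 0))) / real N" .
    have 3: "Re (\<omega> (e 0)) \<le> 1" using state_mono[OF \<omega> e1[of 0]] by (simp add: state_one[OF \<omega>])
    have "(\<Sum>k<N. Re (\<rho> (f k)) - \<epsilon> / 3) \<le> (\<Sum>k<N. Re (\<omega> (e k)))" by (intro sum_mono \<omega>e) simp
    moreover have "(\<Sum>k<N. Re (\<rho> (f k))) = real N * Re (\<rho> h)"
    proof -
      have "(\<Sum>k<N. f k) = real N *\<^sub>R h"
        unfolding f_def scaleR_sum_right[symmetric] sum_lessThan_telescope' by (simp add: p0 pN)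
      then have "\<rho> (\<Sum>k<N. f k) = real N *\<^sub>R \<rho> h" by (simp add: state_linear(3)[OF \<rho>])
      then show ?thesis unfolding state_linear(7)[OF \<rho>] by (simp flip: Re_sum)
    qed
    ultimately have 4: "real N * Re (\<rho> h) - real N * (\<epsilon> / 3) \<le> (\<Sum>k<N. Re (\<omega> (e k)))"
      by (simp add: sum_subtractf)
    have "(real N * Re (\<rho> h) - real N * (\<epsilon> / 3) - 1) / real N \<le> ((\<Sum>k<N. Re (\<omega> (e k))) - Re (\<omega> (e 0))) / real N"
      using 3 4 by (intro divide_right_mono) auto
    moreover have "(real N * Re (\<rho> h) - real N * (\<epsilon> / 3) - 1) / real N = Re (\<rho> h) - \<epsilon> / 3 - inverse (real N)"
      using N(1) by (simp add: field_simps)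
    moreover have "real N * \<delta> = \<epsilon> / 3" using N(1) by (simp add: \<delta>_def)
    ultimately show ?thesis using 1 2 N(2) by linarith
  qed
  ultimately show ?thesis using that by blast
qed

lemma elementary_ucp_almost_dominates:
  fixes y :: "'a::unital_cstar_algebra"
  assumes \<omega>: "state \<omega>" and \<rho>: "state \<rho>"
    and le: "\<And>J. cstar_ideal J \<Longrightarrow> onorm_on J \<rho> \<le> onorm_on J \<omega>"
    and y: "adj y = y" and \<epsilon>: "\<epsilon> > 0"
  obtains \<psi> where "\<psi> \<in> elementary_ucp" "Re (\<rho> y) - \<epsilon> \<le> Re (\<omega> (\<psi> y))"
proof -
  \<comment> \<open>the summand \<open>1\<close> keeps \<open>M\<close> positive when \<open>y = 0\<close>\<close>
  define M where "M = norm y + 1"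
  have M: "M > 0" by (simp add: M_def add_nonneg_pos)
  define h where "h = (1 / (2 * M)) *\<^sub>R (y + M *\<^sub>R 1)"
  have "pos ((norm (- y) *\<^sub>R 1 - (- y)) + 1)"
    by (intro pos_add cle_norm pos_one) (simp add: adj_minus y)
  then have h0: "pos h" unfolding h_def using M by (intro pos_scaleR) (auto simp: M_def algebra_simps)
  have "pos ((1 / (2 * M)) *\<^sub>R ((norm y *\<^sub>R 1 - y) + 1))"
    using M by (intro pos_scaleR pos_add cle_norm pos_one y) simp
  also have "(norm y *\<^sub>R 1 - y) + 1 = M *\<^sub>R 1 + M *\<^sub>R 1 - (y + M *\<^sub>R 1)"
    by (simp add: M_def algebra_simps)
  also have "M *\<^sub>R 1 + M *\<^sub>R 1 = (2 * M) *\<^sub>R (1::'a)" by (simp flip: scaleR_add_left)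
  also have "(1 / (2 * M)) *\<^sub>R ((2 * M) *\<^sub>R 1 - (y + M *\<^sub>R 1)) = 1 - h" using M by (simp add: h_def scaleR_diff_right)
  finally have h1: "h \<preceq> 1" .
  obtain \<psi> where \<psi>: "\<psi> \<in> elementary_ucp" "Re (\<rho> h) - \<epsilon> / (2 * M) \<le> Re (\<omega> (\<psi> h))"
    using elementary_ucp_almost_dominates_unit_interval[OF \<omega> \<rho> le h0 h1, of "\<epsilon> / (2 * M)"] \<epsilon> M by auto
  have "Re (\<rho> h) = (Re (\<rho> y) + M) / (2 * M)"
    by (simp add: h_def state_linear[OF \<rho>] state_one[OF \<rho>])
  moreover have "\<psi> h = (1 / (2 * M)) *\<^sub>R (\<psi> y + M *\<^sub>R 1)"
    using \<psi>(1) unfolding elementary_ucp_iff by (simp add: h_def elementary_cp_linear)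
  then have "Re (\<omega> (\<psi> h)) = (Re (\<omega> (\<psi> y)) + M) / (2 * M)"
    by (simp add: state_linear[OF \<omega>] state_one[OF \<omega>])
  ultimately have "(Re (\<rho> y) + M - \<epsilon>) / (2 * M) \<le> (Re (\<omega> (\<psi> y)) + M) / (2 * M)"
    using \<psi>(2) by (simp add: diff_divide_distrib)
  then have "Re (\<rho> y) - \<epsilon> \<le> Re (\<omega> (\<psi> y))" using M by (simp add: divide_le_cancel)
  then show ?thesis using that \<psi>(1) by blast
qed

section \<open>The weak* closure\<close>

text \<open>
Separation by a near-minimiser instead of a hyperplane theorem. Let \<open>q f\<close> be the squared Euclidean
distance from \<open>f\<close> to \<open>\<rho>\<close> on \<open>X\<close> and suppose its infimum \<open>m\<close> over \<open>C\<close> is positive. The gradient of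
\<open>q\<close> at a near-minimiser \<open>f\<close> is evaluation at an algebra element \<open>y\<close>. By assumption some \<open>g \<in> C\<close>
lies far enough in the descent direction, and a step of size \<open>t\<close> from \<open>f\<close> towards \<open>g\<close> makes \<open>q\<close>
smaller than \<open>m\<close>.
\<close>

lemma convex_set_near_point_if_not_separated:
  fixes C :: "('a::unital_cstar_algebra \<Rightarrow> complex) set"
  assumes conv: "\<And>f g t. f \<in> C \<Longrightarrow> g \<in> C \<Longrightarrow> 0 \<le> t \<Longrightarrow> t \<le> 1 \<Longrightarrow> (\<lambda>x. (1 - t) *\<^sub>R f x + t *\<^sub>R g x) \<in> C"
    and lin: "\<And>f c x. f \<in> C \<Longrightarrow> f (c *\<^sub>C x) = c * f x" "\<And>f (S::'a set) g. f \<in> C \<Longrightarrow> f (sum g S) = (\<Sum>x\<in>S. f (g x))"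
    and lin\<rho>: "\<And>c x. \<rho> (c *\<^sub>C x) = c * \<rho> x" "\<And>(S::'a set) g. \<rho> (sum g S) = (\<Sum>x\<in>S. \<rho> (g x))"
    and bd: "\<And>f x. f \<in> C \<Longrightarrow> cmod (f x) \<le> norm x"
    and sep: "\<And>y e. e > 0 \<Longrightarrow> \<exists>f\<in>C. Re (f y) \<le> Re (\<rho> y) + e"
    and X: "finite X" and e: "e > 0"
  shows "\<exists>f\<in>C. \<forall>x\<in>X. cmod (f x - \<rho> x) < e"
proof -
  define q where "q f = (\<Sum>x\<in>X. (cmod (f x - \<rho> x))\<^sup>2)" for f
  have q0: "0 \<le> q f" for f unfolding q_def by (intro sum_nonneg) simp
  have C: "C \<noteq> {}" using sep[of 1] by auto
  define m where "m = Inf (q ` C)"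
  have bdd: "bdd_below (q ` C)" using q0 by (intro bdd_belowI2)
  have mq: "m \<le> q f" if "f \<in> C" for f unfolding m_def using that bdd by (intro cInf_lower) auto
  have near: "\<exists>f\<in>C. q f < r" if "m < r" for r
    using cInf_lessD[of "q ` C" r] C that unfolding m_def by auto
  have "m \<le> 0"
  proof (rule ccontr)
    assume "\<not> m \<le> 0"
    then have m: "m > 0" by simp
    \<comment> \<open>\<open>K\<close> bounds the coefficient of \<open>t\<^sup>2\<close>; for \<open>t = m / K\<close> the quadratic term is at most \<open>t m\<close>, less than the linear decrease, which is at least \<open>3/2 t m\<close>\<close>
    define K where "K = m + (\<Sum>x\<in>X. (2 * norm x)\<^sup>2)"
    have mK: "m \<le> K" unfolding K_def by (simp add: sum_nonneg)
    then have K: "K > 0" using m by simp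
    define t where "t = m / K"
    have t: "0 < t" "t \<le> 1" using m mK K by (auto simp: t_def)
    obtain f where f: "f \<in> C" "q f < m + t * m / 2" using near[of "m + t * m / 2"] t m by auto
    define y where "y = (\<Sum>x\<in>X. cnj (f x - \<rho> x) *\<^sub>C x)"
    obtain g where g: "g \<in> C" "Re (g y) \<le> Re (\<rho> y) + m / 4" using sep[of "m / 4" y] m by auto
    define D where "D = (\<Sum>x\<in>X. Re (cnj (f x - \<rho> x) * (g x - f x)))"
    have "D = Re (g y) - Re (f y)"
      by (simp add: D_def y_def lin f(1) g(1) sum_subtractf right_diff_distrib flip: Re_sum minus_complex.sel)
    moreover have "q f = Re (f y) - Re (\<rho> y)"
    proof -
      have "(cmod z)\<^sup>2 = Re (cnj z * z)" for z
        unfolding cmod_power2 by (simp add: power2_eq_square)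
      then have "q f = (\<Sum>x\<in>X. Re (cnj (f x - \<rho> x) * (f x - \<rho> x)))" by (simp only: q_def)
      then show ?thesis
        by (simp add: y_def lin lin\<rho> f(1) sum_subtractf right_diff_distrib flip: Re_sum minus_complex.sel)
    qed
    ultimately have D: "D \<le> - (3 / 4) * m" using g(2) mq[OF f(1)] by linarith
    define k where "k x = (1 - t) *\<^sub>R f x + t *\<^sub>R g x" for x
    have kC: "k \<in> C" unfolding k_def using conv[OF f(1) g(1)] t by simp
    have "q k = q f + 2 * t * D + t\<^sup>2 * (\<Sum>x\<in>X. (cmod (g x - f x))\<^sup>2)"
    proof -
      have "(cmod (k x - \<rho> x))\<^sup>2 = (cmod (f x - \<rho> x))\<^sup>2 + 2 * t * Re (cnj (f x - \<rho> x) * (g x - f x))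
          + t\<^sup>2 * (cmod (g x - f x))\<^sup>2" for x
        unfolding cmod_power2 k_def by (simp add: power2_eq_square algebra_simps)
      then show ?thesis by (simp add: q_def D_def sum.distrib sum_distrib_left)
    qed
    also have "\<dots> \<le> q f + 2 * t * (- (3 / 4) * m) + t\<^sup>2 * K"
    proof -
      have "(cmod (g x - f x))\<^sup>2 \<le> (2 * norm x)\<^sup>2" for x
        using norm_triangle_ineq4[of "g x" "f x"] bd[OF f(1), of x] bd[OF g(1), of x]
        by (intro power_mono) auto
      then have "(\<Sum>x\<in>X. (cmod (g x - f x))\<^sup>2) \<le> (\<Sum>x\<in>X. (2 * norm x)\<^sup>2)" by (intro sum_mono)
      then have "(\<Sum>x\<in>X. (cmod (g x - f x))\<^sup>2) \<le> K" using m by (simp add: K_def)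
      then show ?thesis using D t by (intro add_mono mult_left_mono) auto
    qed
    also have "t\<^sup>2 * K = t * m" using K by (simp add: t_def power2_eq_square)
    also have "q f + 2 * t * (- (3 / 4) * m) + t * m = q f - t * m / 2" by simp
    also have "\<dots> < m" using f(2) by simp
    finally show False using mq[OF kC] by simp
  qed
  then have "m < e\<^sup>2" using zero_less_power[OF e, of 2] by linarith
  then obtain f where f: "f \<in> C" "q f < e\<^sup>2" using near by blast
  have "cmod (f x - \<rho> x) < e" if "x \<in> X" for x
  proof (rule power2_less_imp_less)
    have "(cmod (f x - \<rho> x))\<^sup>2 \<le> q f"
      unfolding q_def using X that by (intro member_le_sum[where f="\<lambda>x. (cmod (f x - \<rho> x))\<^sup>2"]) auto
    then show "(cmod (f x - \<rho> x))\<^sup>2 < e\<^sup>2" using f(2) by simp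
  qed (use e in simp)
  then show ?thesis using f(1) by blast
qed

lemma in_weak_star_closureI:
  assumes \<rho>: "\<rho> \<in> cdual" and C: "C \<subseteq> cdual"
    and near: "\<And>X e. finite X \<Longrightarrow> 0 < e \<Longrightarrow> \<exists>f\<in>C. \<forall>x\<in>X. cmod (f x - \<rho> x) < e"
  shows "\<rho> \<in> weak_star_topology closure_of C"
  unfolding in_closure_of
proof (intro conjI allI impI)
  show "\<rho> \<in> topspace weak_star_topology" using \<rho> by (simp add: weak_star_topology_def)
  fix T assume T: "\<rho> \<in> T \<and> openin weak_star_topology T"
  then obtain U where U: "openin (product_topology (\<lambda>_. euclidean) UNIV) U" "T = U \<inter> cdual"
    unfolding weak_star_topology_def openin_subtopology by blast
  then obtain V where V: "finite {i. V i \<noteq> UNIV}" "\<And>i. open (V i)" "\<And>i. \<rho> i \<in> V i" "PiE UNIV V \<subseteq> U"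
    using T unfolding openin_product_topology_alt by (auto simp: PiE_iff)
  have "\<exists>r>0. ball (\<rho> i) r \<subseteq> V i" for i using V(2,3) by (meson openE)
  then obtain r where r: "\<And>i. r i > 0" "\<And>i. ball (\<rho> i) (r i) \<subseteq> V i" by metis
  define e where "e = Min (insert 1 (r ` {i. V i \<noteq> UNIV}))"
  have e: "e > 0" unfolding e_def using V(1) r(1) by (subst Min_gr_iff) auto
  obtain f where f: "f \<in> C" "\<And>i. V i \<noteq> UNIV \<Longrightarrow> cmod (f i - \<rho> i) < e" using near[OF V(1) e] by auto
  have "f i \<in> V i" for i
  proof (cases "V i = UNIV")
    case False
    then have "e \<le> r i" unfolding e_def using V(1) by (intro Min_le) auto
    then have "f i \<in> ball (\<rho> i) (r i)" using f(2)[OF False] by (simp add: dist_norm norm_minus_commute)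
    then show ?thesis using r(2) by blast
  qed simp
  then have "f \<in> T" using V(4) U(2) f(1) C by (auto simp: PiE_iff)
  then show "\<exists>y. y \<in> C \<and> y \<in> T" using f(1) by blast
qed

lemma weak_star_closure_bound:
  assumes "\<rho> \<in> weak_star_topology closure_of C" and b: "\<And>f. f \<in> C \<Longrightarrow> cmod (f x) \<le> c"
  shows "cmod (\<rho> x) \<le> c"
proof (rule ccontr)
  assume "\<not> cmod (\<rho> x) \<le> c"
  define T where "T = {f \<in> topspace weak_star_topology. f x \<in> - cball 0 c}"
  have "continuous_map weak_star_topology euclidean (\<lambda>f. f x)"
    unfolding weak_star_topology_def
    by (intro continuous_map_from_subtopology continuous_map_product_projection) simp
  then have "openin weak_star_topology T"
    unfolding T_def by (rule openin_continuous_map_preimage) auto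
  moreover have "\<rho> \<in> T" using assms(1) \<open>\<not> cmod (\<rho> x) \<le> c\<close> by (simp add: T_def in_closure_of)
  ultimately obtain f where "f \<in> C" "f \<in> T" using assms(1) unfolding in_closure_of by blast
  then show False using b by (auto simp: T_def)
qed

lemma elementary_cp_cscale: "\<phi> \<in> elementary_cp \<Longrightarrow> \<phi> (c *\<^sub>C x) = c *\<^sub>C \<phi> x"
  by (induction rule: elementary_cp.induct) (simp_all add: cscale_add_right cscale_mult_left cscale_mult_right)

lemma state_comp_elementary_ucp_in_cdual:
  assumes "state \<omega>" "\<psi> \<in> elementary_ucp"
  shows "\<omega> \<circ> \<psi> \<in> cdual"
proof -
  have \<psi>: "\<psi> \<in> elementary_cp" "\<psi> 1 = 1" using assms(2) by (simp_all add: elementary_ucp_iff)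
  have "bounded_linear \<psi>"
    by (rule bounded_linear_intro[where K=1])
       (simp_all add: elementary_cp_linear[OF \<psi>(1)] elementary_cp_contractive[OF \<psi>])
  then show ?thesis
    unfolding cdual_def using state_bounded_linear[OF assms(1)]
    by (simp add: o_def bounded_linear_compose elementary_cp_cscale[OF \<psi>(1)] state_linear[OF assms(1)])
qed

theorem theorem3p4:
  fixes \<omega> \<rho> :: "'a::unital_cstar_algebra \<Rightarrow> complex"
  assumes "state \<omega>" and "state \<rho>"
  shows "\<rho> \<in> weak_star_topology closure_of {\<omega> \<circ> \<psi> | \<psi>. \<psi> \<in> elementary_ucp} \<longleftrightarrow>
    (\<forall>J. cstar_ideal J \<longrightarrow> onorm_on J \<rho> \<le> onorm_on J \<omega>)"
proof (intro iffI allI impI)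
  fix J :: "'a set"
  assume cl: "\<rho> \<in> weak_star_topology closure_of {\<omega> \<circ> \<psi> | \<psi>. \<psi> \<in> elementary_ucp}" and J: "cstar_ideal J"
  have 0: "0 \<in> J" using J by (simp add: cstar_ideal_def)
  have nn: "0 \<le> onorm_on J \<omega>" using state_bounded_linear[OF assms(1)] 0 by (rule onorm_on_nonneg)
  show "onorm_on J \<rho> \<le> onorm_on J \<omega>"
  proof (rule onorm_on_le[OF 0 nn], rule weak_star_closure_bound[OF cl])
    fix x f assume x: "x \<in> J" and "f \<in> {\<omega> \<circ> \<psi> | \<psi>. \<psi> \<in> elementary_ucp}"
    then obtain \<psi> where f: "f = \<omega> \<circ> \<psi>" and \<psi>: "\<psi> \<in> elementary_cp" "\<psi> 1 = 1"
      by (auto simp: elementary_ucp_iff)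
    have "cmod (\<omega> (\<psi> x)) \<le> onorm_on J \<omega> * norm (\<psi> x)"
      by (rule norm_le_onorm_on[OF state_bounded_linear[OF assms(1)] elementary_cp_in_ideal[OF \<psi>(1) J x]])
    also have "\<dots> \<le> onorm_on J \<omega> * norm x"
      by (rule mult_left_mono[OF elementary_cp_contractive[OF \<psi>] nn])
    finally show "cmod (f x) \<le> onorm_on J \<omega> * norm x" by (simp add: f)
  qed
next
  assume le: "\<forall>J. cstar_ideal J \<longrightarrow> onorm_on J \<rho> \<le> onorm_on J \<omega>"
  define C where "C = {\<omega> \<circ> \<psi> | \<psi>. \<psi> \<in> elementary_ucp}"
  have Cdual: "C \<subseteq> cdual" using state_comp_elementary_ucp_in_cdual[OF assms(1)] by (auto simp: C_def)
  have lin: "f (c *\<^sub>C x) = c * f x" "f (sum g S) = (\<Sum>x\<in>S. f (g x))" "f (- x) = - f x"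
    "f (x + y) = f x + f y" "f (r *\<^sub>R x) = r *\<^sub>R f x"
    if "f \<in> cdual" for f :: "'a \<Rightarrow> complex" and c x y r g and S :: "'a set"
    using that by (auto simp: cdual_def bounded_linear.linear linear_sum linear_neg linear_add linear_scale)
  have "\<rho> \<in> weak_star_topology closure_of C"
  proof (rule in_weak_star_closureI[OF _ Cdual], goal_cases)
    case 1
    show "\<rho> \<in> cdual" using assms(2) by (simp add: state_def)
  next
    case (2 X e)
    show ?case
    proof (rule convex_set_near_point_if_not_separated[OF _ _ _ _ _ _ _ 2])
      fix f g :: "'a \<Rightarrow> complex" and t :: real
      assume "f \<in> C" "g \<in> C" and t: "0 \<le> t" "t \<le> 1"
      then obtain \<phi> \<psi> where \<phi>: "\<phi> \<in> elementary_ucp" "f = \<omega> \<circ> \<phi>" and \<psi>: "\<psi> \<in> elementary_ucp" "g = \<omega> \<circ> \<psi>"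
        by (auto simp: C_def)
      have "(\<lambda>x. (1 - t) *\<^sub>R f x + t *\<^sub>R g x) = \<omega> \<circ> (\<lambda>x. (1 - t) *\<^sub>R \<phi> x + t *\<^sub>R \<psi> x)"
        by (simp add: \<phi> \<psi> o_def state_linear[OF assms(1)])
      then show "(\<lambda>x. (1 - t) *\<^sub>R f x + t *\<^sub>R g x) \<in> C"
        unfolding C_def using elementary_ucp_convex[OF \<phi>(1) \<psi>(1) t] by blast
    next
      fix f x assume "f \<in> C"
      then obtain \<psi> where f: "f = \<omega> \<circ> \<psi>" and \<psi>: "\<psi> \<in> elementary_cp" "\<psi> 1 = 1"
        by (auto simp: C_def elementary_ucp_iff)
      show "cmod (f x) \<le> norm x"
        using state_norm_le[OF assms(1), of "\<psi> x"] elementary_cp_contractive[OF \<psi>, of x] by (simp add: f)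
    next
      fix y :: 'a and e :: real assume e: "e > 0"
      \<comment> \<open>the functionals are hermitian, so only the real part \<open>z\<close> of \<open>y\<close> counts; the sign turns a lower bound into an upper one\<close>
      define z where "z = (1/2) *\<^sub>R (y + adj y)"
      have az: "adj (- z) = - z" by (simp add: z_def adj_minus adj_scaleR adj_add adj_adj add.commute)
      have Re_z: "Re (f z) = Re (f y)" if f: "f \<in> cdual" and a: "\<And>x. f (adj x) = cnj (f x)" for f
        by (simp add: z_def lin[OF f] a)
      obtain \<psi> where \<psi>: "\<psi> \<in> elementary_ucp" "Re (\<rho> (- z)) - e \<le> Re (\<omega> (\<psi> (- z)))"
        using elementary_ucp_almost_dominates[OF assms _ az e] le by blast
      have d: "\<omega> \<circ> \<psi> \<in> cdual" by (rule state_comp_elementary_ucp_in_cdual[OF assms(1) \<psi>(1)])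
      have "Re ((\<omega> \<circ> \<psi>) z) = Re ((\<omega> \<circ> \<psi>) y)"
        using \<psi>(1) by (intro Re_z d) (simp add: elementary_ucp_iff elementary_cp_adj state_adj[OF assms(1)])
      moreover have "Re (\<rho> z) = Re (\<rho> y)"
        by (rule Re_z) (use assms(2) in \<open>simp_all add: state_def state_adj[OF assms(2)]\<close>)
      moreover have "(\<omega> \<circ> \<psi>) (- z) = - (\<omega> \<circ> \<psi>) z" by (rule lin(3)[OF d])
      ultimately have "Re ((\<omega> \<circ> \<psi>) y) \<le> Re (\<rho> y) + e"
        using \<psi>(2) by (simp add: state_linear[OF assms(2)])
      then show "\<exists>f\<in>C. Re (f y) \<le> Re (\<rho> y) + e" using \<psi>(1) by (auto simp: C_def)
    qed (use lin Cdual assms(2) in \<open>auto simp: state_def\<close>)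
  qed
  then show "\<rho> \<in> weak_star_topology closure_of {\<omega> \<circ> \<psi> | \<psi>. \<psi> \<in> elementary_ucp}" by (simp only: C_def)
qed

end
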